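(* Non-generic ordered right-angled hexagons of type 1 in the Siegel space of $\mathrm{Sp}(4,\mathbb R)$ are parametrized up to isometry by $$\mathcal H^{nongen}_{type1.1}/\mathrm{PSp}(4,\mathbb R)\cong\mathfrak d\times\mathfrak a^2\times[0,2\pi)/_\sim,$$ $$\mathcal H^{nongen}_{type1.2}/\mathrm{PSp}(4,\mathbb R)\cong\mathfrak a\times\mathfrak d\times\mathfrak a\times[0,2\pi)/_\sim,$$ $$\mathcal H^{nongen}_{type1.3}/\mathrm{PSp}(4,\mathbb R)\cong\mathfrak a^2\times\mathfrak d\times[0,2\pi)/_\sim,$$ where for $\alpha\in[0,2\pi)$ the equivalence relation is given by $\alpha\sim2\pi-\alpha$.
   Context: $\mathrm{PSp}(4,\mathbb R)=\mathrm{Sp}(4,\mathbb R)/\{\pm\mathrm{Id}\}$, where $\mathrm{Sp}(4,\mathbb R)$ preserves the symplectic form with matrix $\begin{pmatrix}0&\mathrm{Id}\\-\mathrm{Id}&0\end{pmatrix}$. The Siegel space is $\mathcal X=\{X+iY: X\in\mathrm{Sym}(2,\mathbb R),\ Y\in\mathrm{Sym}^+(2,\mathbb R)\}$, the symmetric space of $\mathrm{Sp}(4,\mathbb R)$. A (real or complex) symmetric matrix $X$ denotes the Lagrangian spanned by the columns of $\binom{X}{\mathrm{Id}}$, and $\infty=\langle e_1,e_2\rangle$. A triple of pairwise transverse real Lagrangians is maximal if it is in the $\mathrm{Sp}(4,\mathbb R)$-orbit of $(\infty,0,\mathrm{Id})$; an $m$-tuple is maximal if all its subtriples with increasing indices are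 maximal. Cross-ratio: $R(l_1,l_2,l_3,l_4)=p_{l_1}^{\|l_2}\circ p_{l_4}^{\|l_3}|_{l_1}$, where $p_l^{\|l'}$ is the projection to $l$ parallel to $l'$ (for example $R(0,Z,X,\infty)=Z^{-1}X$). A maximal quadruple $(P,X,Y,Q)$ is generic if the two eigenvalues of $R(P,X,Y,Q)$ are distinct and non-generic if they are equal. For transverse real Lagrangians $a,b$, the $\mathbb R$-tube $\mathcal Y_{a,b}$ is the set of $l\in\mathcal X$ with $R(a,l,\bar l,b)=-\mathrm{Id}$; two tubes are orthogonal if they are orthogonal as submanifolds of $\mathcal X$. A right-angled hexagon is a cyclic sequence of six $\mathbb R$-tubes, any two consecutive ones orthogonal, of the form $[\mathcal Y_{P_1,P_2},\mathcal Y_{Q_1,Q_2},\mathcal Y_{P_3,P_4},\mathcal Y_{Q_3,Q_4},\mathcal Y_{P_5,P_6},\mathcal Y_{Q_5,Q_6}]$ for a maximal 12-tuple $(P_1,Q_6,Q_1,P_2,P_3,Q_2,Q_3,P_4,P_5,Q_4,Q_5,P_6)$. An ordered right-angled hexagon is such a hexagon together with the choice of its first tube $\mathcal Y_{P_1,P_2}$; it is uniquely determined by, and identified with, the maximal 6-tuple $(P,A,B,C,D,Q):=(P_2,Q_2,P_4,P_5,Q_5,P_1)$. The group $\mathrm{PSp}(4,\mathbb R)$ acts diagonally on such 6-tuples. $\mathcal H^{nongen}_{type1.1}$ (resp. $\mathcal H^{nongen}_{type1.2}$, $\mathcal H^{nongen}_{type1.3}$) is the set of maximal 6-tuples $(P,A,B,C,D,Q)$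 such that, among the quadruples $(P,A,B,Q)$, $(P,B,C,Q)$, $(P,C,D,Q)$, the first (resp. second, third) is non-generic and the other two are generic. $\mathfrak a=\{(x_1,x_2)\in\mathbb R^2:x_1>x_2>0\}$ and $\mathfrak d=\{(x_1,x_2)\in\mathbb R^2:x_1=x_2>0\}$. *)

theory Defs
  imports "HOL-Analysis.Analysis" "HOL-Algebra.Coset"
begin

section \<open>Quotient topologies\<close>

text \<open>The finest topology on the image of \<open>f\<close> for which \<open>f\<close> is continuous.\<close>

definition quotient_topology :: "'a topology \<Rightarrow> ('a \<Rightarrow> 'b) \<Rightarrow> 'b topology" where
  "quotient_topology T f =
     topology (\<lambda>U. U \<subseteq> f ` topspace T \<and> openin T {x \<in> topspace T. f x \<in> U})"

lemma openin_quotient_topology: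
  "openin (quotient_topology T f) U \<longleftrightarrow>
     U \<subseteq> f ` topspace T \<and> openin T {x \<in> topspace T. f x \<in> U}"
proof -
  have "istopology (\<lambda>U. U \<subseteq> f ` topspace T \<and> openin T {x \<in> topspace T. f x \<in> U})"
    unfolding istopology_def
  proof (intro conjI allI impI; (elim conjE)?)
    fix S U
    assume S: "openin T {x \<in> topspace T. f x \<in> S}" and U: "openin T {x \<in> topspace T. f x \<in> U}"
    have "{x \<in> topspace T. f x \<in> S \<inter> U} =
        {x \<in> topspace T. f x \<in> S} \<inter> {x \<in> topspace T. f x \<in> U}"
      by blast
    with openin_Int[OF S U] show "openin T {x \<in> topspace T. f x \<in> S \<inter> U}"
      by simp
  next
    fix K
    assume K: "\<forall>U\<in>K. U \<subseteq> f ` topspace T \<and> openin T {x \<in> topspace T. f x \<in> U}"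
    have "{x \<in> topspace T. f x \<in> \<Union>K} = (\<Union>U\<in>K. {x \<in> topspace T. f x \<in> U})"
      by blast
    with K show "openin T {x \<in> topspace T. f x \<in> \<Union>K}"
      by auto
  qed blast+
  then show ?thesis
    by (simp add: quotient_topology_def)
qed

lemma topspace_quotient_topology [simp]:
  "topspace (quotient_topology T f) = f ` topspace T"
proof -
  have "{x \<in> topspace T. f x \<in> f ` topspace T} = topspace T"
    by blast
  then have "openin (quotient_topology T f) (f ` topspace T)"
    by (simp add: openin_quotient_topology)
  then show ?thesis
    by (metis openin_quotient_topology openin_subset openin_topspace subset_antisym)
qed


section \<open>The groups \<open>Sp(4,\<real>)\<close> and \<open>PSp(4,\<real>)\<close>\<close>

definition J4 :: "real^4^4" where
  "J4 = vector [axis 3 1, axis 4 1, - axis 1 1, - axis 2 1]"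

definition Sp4 :: "(real^4^4) monoid" where
  "Sp4 = \<lparr>carrier = {A. transpose A ** J4 ** A = J4}, mult = (**), one = mat 1\<rparr>"

definition PSp4 :: "(real^4^4) set monoid" where
  "PSp4 = Sp4 Mod {mat 1, - mat 1}"

lemma J4_square: "J4 ** J4 = - mat 1"
  by (simp add: vec_eq_iff forall_4 J4_def vector_def matrix_matrix_mult_def sum_4 axis_def mat_def)

lemma matrix_mul_minus:
  fixes A B :: "real^4^4"
  shows "(- A) ** B = - (A ** B)" "A ** (- B) = - (A ** B)"
  by (simp_all add: matrix_matrix_mult_def vec_eq_iff sum_negf)

lemma group_Sp4: "group Sp4"
proof (rule groupI)
  fix A B
  assume "A \<in> carrier Sp4" "B \<in> carrier Sp4"
  then have A: "transpose A ** J4 ** A = J4" and B: "transpose B ** J4 ** B = J4"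
    by (auto simp: Sp4_def)
  have "transpose (A ** B) ** J4 ** (A ** B) = transpose B ** (transpose A ** J4 ** A) ** B"
    by (simp add: matrix_transpose_mul matrix_mul_assoc)
  then show "A \<otimes>\<^bsub>Sp4\<^esub> B \<in> carrier Sp4"
    by (simp add: Sp4_def A B)
next
  fix A
  assume "A \<in> carrier Sp4"
  then have A: "transpose A ** J4 ** A = J4"
    by (simp add: Sp4_def)
  define B where "B = (- J4) ** transpose A ** J4"
  have "B ** A = (- J4) ** (transpose A ** J4 ** A)"
    by (simp add: B_def matrix_mul_assoc)
  also have "\<dots> = mat 1"
    by (simp add: A J4_square matrix_mul_minus)
  finally have BA: "B ** A = mat 1" .
  then have AB: "A ** B = mat 1"
    by (simp add: matrix_left_right_inverse)
  have "transpose B ** J4 ** B = transpose (A ** B) ** J4 ** (A ** B)"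
    by (subst A[symmetric]) (simp add: matrix_transpose_mul matrix_mul_assoc)
  then have "B \<in> carrier Sp4"
    by (simp add: AB Sp4_def)
  with BA show "\<exists>B\<in>carrier Sp4. B \<otimes>\<^bsub>Sp4\<^esub> A = \<one>\<^bsub>Sp4\<^esub>"
    by (auto simp: Sp4_def)
qed (auto simp: Sp4_def matrix_mul_assoc)

lemma normal_pm1_Sp4: "{mat 1, - mat 1} \<lhd> Sp4"
proof -
  interpret group Sp4
    by (rule group_Sp4)
  have tr: "transpose (- mat 1 :: real^4^4) = - mat 1"
    by (simp add: transpose_def vec_eq_iff mat_def)
  have minus1: "- mat 1 \<in> carrier Sp4"
    by (simp add: Sp4_def tr matrix_mul_minus)
  then have "inv\<^bsub>Sp4\<^esub> (- mat 1) = - mat 1"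
    by (intro inv_equality) (auto simp: Sp4_def matrix_mul_minus)
  moreover have "inv\<^bsub>Sp4\<^esub> (mat 1) = mat 1"
    using inv_one by (simp add: Sp4_def)
  ultimately have "subgroup {mat 1, - mat 1} Sp4"
    using minus1 by (intro subgroupI) (auto simp: Sp4_def matrix_mul_minus)
  then show ?thesis
    by (rule normalI) (auto simp: r_coset_def l_coset_def Sp4_def matrix_mul_minus)
qed


section \<open>Lagrangians\<close>

text \<open>The Grassmannian of 2-planes in \<open>\<real>\<^sup>4\<close>; sets of Lagrangians carry the subspace topology.\<close>

definition grass :: "(real^4) set topology" where
  "grass = quotient_topology (top_of_set {F :: real^2^4. rank F = 2}) (\<lambda>F. span (columns F))"

definition lagrangian :: "(real^4) set \<Rightarrow> bool" where
  "lagrangian l \<longleftrightarrow> subspace l \<and> dim l = 2 \<and> (\<forall>v\<in>l. \<forall>w\<in>l. v \<bullet> (J4 *v w) = 0)"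

definition transverse :: "(real^4) set \<Rightarrow> (real^4) set \<Rightarrow> bool" where
  "transverse l l' \<longleftrightarrow> l \<inter> l' = {0}"

definition lag_inf :: "(real^4) set" where
  "lag_inf = span {axis 1 1, axis 2 1}"

text \<open>The span of the columns of the \<open>4 \<times> 2\<close> matrix with upper block \<open>X\<close> and lower block
  the identity.\<close>

definition lag_mat :: "real^2^2 \<Rightarrow> (real^4) set" where
  "lag_mat X = span (columns (vector [X $ 1, X $ 2, axis 1 1, axis 2 1] :: real^2^4))"

definition maximal_triple ::
    "(real^4) set \<Rightarrow> (real^4) set \<Rightarrow> (real^4) set \<Rightarrow> bool" where
  "maximal_triple l1 l2 l3 \<longleftrightarrow>
     lagrangian l1 \<and> lagrangian l2 \<and> lagrangian l3 \<and>
     transverse l1 l2 \<and> transverse l1 l3 \<and> transverse l2 l3 \<and>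
     (\<exists>g\<in>carrier Sp4. l1 = (*v) g ` lag_inf \<and> l2 = (*v) g ` lag_mat 0 \<and>
        l3 = (*v) g ` lag_mat (mat 1))"

definition maximal :: "(real^4) set list \<Rightarrow> bool" where
  "maximal ls \<longleftrightarrow>
     (\<forall>i j k. i < j \<and> j < k \<and> k < length ls \<longrightarrow> maximal_triple (ls ! i) (ls ! j) (ls ! k))"


section \<open>Cross-ratio and genericity\<close>

text \<open>Projection to \<open>l\<close> parallel to \<open>l'\<close>, meaningful when \<open>l\<close> and \<open>l'\<close> are complementary.\<close>

definition proj_par :: "(real^4) set \<Rightarrow> (real^4) set \<Rightarrow> real^4 \<Rightarrow> real^4" where
  "proj_par l l' v = (THE u. u \<in> l \<and> v - u \<in> l')"

text \<open>As an endomorphism of \<open>l1\<close>: only the values on \<open>l1\<close> matter.\<close>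

definition cross_ratio ::
    "(real^4) set \<Rightarrow> (real^4) set \<Rightarrow> (real^4) set \<Rightarrow> (real^4) set \<Rightarrow> real^4 \<Rightarrow> real^4" where
  "cross_ratio l1 l2 l3 l4 = proj_par l1 l2 \<circ> proj_par l4 l3"

definition eigenvalues_on :: "(real^4) set \<Rightarrow> (real^4 \<Rightarrow> real^4) \<Rightarrow> real set" where
  "eigenvalues_on l f = {c. \<exists>v\<in>l. v \<noteq> 0 \<and> f v = c *\<^sub>R v}"

text \<open>For a maximal quadruple \<open>(P,X,Y,Q)\<close> one can move \<open>(P,Q)\<close> to \<open>(0,\<infinity>)\<close>, and then the
  cross-ratio is \<open>X\<inverse>Y\<close> with \<open>X\<close>, \<open>Y\<close> positive definite. Such an endomorphism of a
  2-dimensional space is diagonalizable over \<open>\<real>\<close>, so its two eigenvalues are distinct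
  (equal) exactly if its set of real eigenvalues has two elements (one element).\<close>

definition generic ::
    "(real^4) set \<Rightarrow> (real^4) set \<Rightarrow> (real^4) set \<Rightarrow> (real^4) set \<Rightarrow> bool" where
  "generic P X Y Q \<longleftrightarrow> maximal [P, X, Y, Q] \<and> card (eigenvalues_on P (cross_ratio P X Y Q)) = 2"

definition nongeneric ::
    "(real^4) set \<Rightarrow> (real^4) set \<Rightarrow> (real^4) set \<Rightarrow> (real^4) set \<Rightarrow> bool" where
  "nongeneric P X Y Q \<longleftrightarrow> maximal [P, X, Y, Q] \<and> card (eigenvalues_on P (cross_ratio P X Y Q)) = 1"


section \<open>Ordered right-angled hexagons\<close>

text \<open>An ordered right-angled hexagon is identified with a maximal 6-tuple \<open>(P,A,B,C,D,Q)\<close>.\<close>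

type_synonym hexagon =
  "(real^4) set \<times> (real^4) set \<times> (real^4) set \<times> (real^4) set \<times> (real^4) set \<times> (real^4) set"

definition hexagon_topology :: "hexagon topology" where
  "hexagon_topology =
     prod_topology grass (prod_topology grass (prod_topology grass
       (prod_topology grass (prod_topology grass grass))))"

definition H_nongen_type1_1 :: "hexagon set" where
  "H_nongen_type1_1 = {(P,A,B,C,D,Q). maximal [P,A,B,C,D,Q] \<and>
     nongeneric P A B Q \<and> generic P B C Q \<and> generic P C D Q}"

definition H_nongen_type1_2 :: "hexagon set" where
  "H_nongen_type1_2 = {(P,A,B,C,D,Q). maximal [P,A,B,C,D,Q] \<and>
     generic P A B Q \<and> nongeneric P B C Q \<and> generic P C D Q}"

definition H_nongen_type1_3 :: "hexagon set" where
  "H_nongen_type1_3 = {(P,A,B,C,D,Q). maximal [P,A,B,C,D,Q] \<and>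
     generic P A B Q \<and> generic P B C Q \<and> nongeneric P C D Q}"

text \<open>An element of \<open>PSp(4,\<real>)\<close> is a coset \<open>S = {g, -g}\<close>; since \<open>g\<close> and \<open>-g\<close> map a subspace
  to the same subspace, the union below is \<open>(*v) g ` l\<close>.\<close>

definition psp_act :: "(real^4^4) set \<Rightarrow> (real^4) set \<Rightarrow> (real^4) set" where
  "psp_act S l = (\<Union>g\<in>S. (*v) g ` l)"

definition psp_act_hexagon :: "(real^4^4) set \<Rightarrow> hexagon \<Rightarrow> hexagon" where
  "psp_act_hexagon S = (\<lambda>(P,A,B,C,D,Q).
     (psp_act S P, psp_act S A, psp_act S B, psp_act S C, psp_act S D, psp_act S Q))"

definition psp_orbit :: "hexagon \<Rightarrow> hexagon set" where
  "psp_orbit h = {psp_act_hexagon S h | S. S \<in> carrier PSp4}"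

definition mod_PSp4 :: "hexagon set \<Rightarrow> hexagon set topology" where
  "mod_PSp4 H = quotient_topology (subtopology hexagon_topology H) psp_orbit"


section \<open>Parameter spaces\<close>

definition aa :: "(real \<times> real) set" where
  "aa = {(x1, x2). x1 > x2 \<and> x2 > 0}"

definition dd :: "(real \<times> real) set" where
  "dd = {(x1, x2). x1 = x2 \<and> x2 > 0}"

definition angle_rel :: "(real \<times> real) set" where
  "angle_rel = {(\<alpha>, \<beta>). \<alpha> \<in> {0..<2*pi} \<and> \<beta> \<in> {0..<2*pi} \<and> (\<beta> = \<alpha> \<or> \<beta> = 2*pi - \<alpha>)}"

lemma equiv_angle_rel: "equiv {0..<2*pi} angle_rel"
  by (rule equivI) (auto simp: angle_rel_def refl_on_def sym_def trans_def)

definition angle_space :: "real set topology" where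
  "angle_space = quotient_topology (top_of_set {0..<2*pi}) (\<lambda>\<alpha>. angle_rel `` {\<alpha>})"

end

theory Submission
  imports Defs
begin

text \<open>Move \<open>P, A, Q\<close> to \<open>0, 1, \<infinity>\<close>. A maximal 6-tuple becomes a chain \<open>1 < B < C < D\<close> of symmetric
  matrices in the Loewner order, and \<open>R(P,X,Y,Q)\<close> becomes \<open>X\<inverse>Y\<close>. At the non-generic step \<open>X\<inverse>Y\<close>
  is a scalar \<open>l > 1\<close>; dividing the later matrices by \<open>l\<close> leaves a triple \<open>1 < M < N\<close> with
  \<open>M\<close> and \<open>M\<inverse>N\<close> both generic, up to the action of the stabiliser \<open>O(2)\<close>. Diagonalising \<open>M\<close>
  exhausts \<open>O(2)\<close> up to signs, so that the orbit is determined by the spectra of \<open>M\<close> and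
  \<open>M\<inverse>N\<close> and by the angle \<open>\<alpha>/2\<close> between their eigenbases up to sign, that is by \<open>cos \<alpha>\<close>.

  All these numbers are traces and determinants of cross-ratio matrices computed in arbitrary
  frames of the six planes, so they are continuous on the space of frames, whose projection to the
  Grassmannians is open; the normal form provides a continuous section.\<close>

section \<open>Symplectic linear algebra and maximal triples\<close>

text \<open>The signs left over after diagonalising M are the matrices diag(1, -1) and diag(-1, 1),
  besides plus or minus the identity: they flip the off-diagonal entry of N, which exchanges
  \<alpha> with 2 pi - \<alpha>. The values cos \<alpha> = 1 and cos \<alpha> = -1 do occur, namely
  when M and N commute, so the last factor is a closed interval. All cross-ratio eigenvalues exceed
  1, and their logarithms are the coordinates in \<open>aa\<close> and \<open>dd\<close>.

  The obstacle is topological. The Grassmannian is given only as a quotient of the space of frames,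
  and quotient maps are in general preserved neither by products nor by restriction to the preimage
  of a subset. Open maps survive both operations, which is why openness is established at the level
  of a single plane and then carried along. Eigenvectors never have to be chosen continuously:
  sorted eigenvalues come from a square root of the discriminant, and the angle from the trace of a
  product.\<close>

lemma vector_4 [simp]:
  "(vector [a, b, c, d] :: 'a::zero^4) $ 1 = a"
  "(vector [a, b, c, d] :: 'a::zero^4) $ 2 = b"
  "(vector [a, b, c, d] :: 'a::zero^4) $ 3 = c"
  "(vector [a, b, c, d] :: 'a::zero^4) $ 4 = d"
  by (simp_all add: vector_def)

definition vec4 :: "real^2 \<Rightarrow> real^2 \<Rightarrow> real^4" where
  "vec4 x y = vector [x $ 1, x $ 2, y $ 1, y $ 2]"

lemma vec4_nth [simp]:
  "vec4 x y $ 1 = x $ 1" "vec4 x y $ 2 = x $ 2" "vec4 x y $ 3 = y $ 1" "vec4 x y $ 4 = y $ 2"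
  by (simp_all add: vec4_def)

lemma vec4_eq_iff [simp]: "vec4 x y = vec4 x' y' \<longleftrightarrow> x = x' \<and> y = y'"
  by (auto simp: vec_eq_iff forall_2 forall_4)

lemma vec4_eq_0_iff [simp]: "vec4 x y = 0 \<longleftrightarrow> x = 0 \<and> y = 0"
  by (auto simp: vec_eq_iff forall_2 forall_4)

lemma vec4_0 [simp]: "vec4 0 0 = 0"
  by simp

lemma vec4_cases: obtains x y where "v = vec4 x y"
proof
  show "v = vec4 (vector [v $ 1, v $ 2]) (vector [v $ 3, v $ 4])"
    by (simp add: vec_eq_iff forall_4)
qed

lemma vec4_arith:
  "vec4 x y + vec4 x' y' = vec4 (x + x') (y + y')"
  "vec4 x y - vec4 x' y' = vec4 (x - x') (y - y')"
  "c *\<^sub>R vec4 x y = vec4 (c *\<^sub>R x) (c *\<^sub>R y)"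
  "- vec4 x y = vec4 (- x) (- y)"
  by (simp_all add: vec_eq_iff forall_4)

section \<open>The symplectic form and its isometries\<close>

definition sform :: "real^4 \<Rightarrow> real^4 \<Rightarrow> real" where
  "sform v w = v \<bullet> (J4 *v w)"

lemma sform_vec4 [simp]: "sform (vec4 x y) (vec4 x' y') = x \<bullet> y' - y \<bullet> x'"
  by (simp add: sform_def J4_def inner_vec_def sum_4 sum_2 matrix_vector_mult_def axis_def)

lemma sform_bilinear:
  "sform (u + v) w = sform u w + sform v w" "sform w (u + v) = sform w u + sform w v"
  "sform (u - v) w = sform u w - sform v w" "sform w (u - v) = sform w u - sform w v"
  "sform (c *\<^sub>R v) w = c * sform v w" "sform w (c *\<^sub>R v) = c * sform w v"
  "sform (- v) w = - sform v w" "sform w (- v) = - sform w v"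
  by (cases u rule: vec4_cases; cases v rule: vec4_cases; cases w rule: vec4_cases;
      simp add: vec4_arith inner_simps algebra_simps)+

lemma sform_skew: "sform v w = - sform w v"
  by (cases v rule: vec4_cases; cases w rule: vec4_cases) (simp add: inner_commute)

lemma sform_self [simp]: "sform v v = 0"
  using sform_skew[of v v] by simp

lemma lagrangian_altdef:
  "lagrangian l \<longleftrightarrow> subspace l \<and> dim l = 2 \<and> (\<forall>v\<in>l. \<forall>w\<in>l. sform v w = 0)"
  by (simp add: lagrangian_def sform_def)

text \<open>A bilinear form determines its matrix. In this form, membership is checked on
  \<open>vec4\<close> coordinates.\<close>

lemma carrier_Sp4_iff: "g \<in> carrier Sp4 \<longleftrightarrow> (\<forall>v w. sform (g *v v) (g *v w) = sform v w)"
proof -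
  have *: "sform (g *v v) (g *v w) = v \<bullet> ((transpose g ** J4 ** g) *v w)" for v w
  proof -
    have "v \<bullet> (transpose g *v z) = (g *v v) \<bullet> z" for z
      by (metis dot_lmul_matrix inner_commute transpose_matrix_vector)
    then show ?thesis by (simp add: sform_def flip: matrix_vector_mul_assoc)
  qed
  have "transpose g ** J4 ** g = J4 \<longleftrightarrow>
      (\<forall>v w. v \<bullet> ((transpose g ** J4 ** g) *v w) = v \<bullet> (J4 *v w))"
    unfolding matrix_eq by (metis vector_eq_ldot)
  then show ?thesis
    by (simp add: Sp4_def *) (simp add: sform_def)
qed

lemma Sp4_inverse:
  assumes "g \<in> carrier Sp4"
  obtains h where "h \<in> carrier Sp4" "h ** g = mat 1" "g ** h = mat 1"
proof -
  interpret group Sp4 by (rule group_Sp4)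
  show ?thesis
    using that[of "inv\<^bsub>Sp4\<^esub> g"] inv_closed[OF assms] l_inv[OF assms] r_inv[OF assms]
    by (simp add: Sp4_def)
qed

lemma Sp4_mult: "g \<in> carrier Sp4 \<Longrightarrow> h \<in> carrier Sp4 \<Longrightarrow> g ** h \<in> carrier Sp4"
  by (simp add: carrier_Sp4_iff flip: matrix_vector_mul_assoc)

lemma Sp4_inj: assumes "g \<in> carrier Sp4" shows "inj ((*v) g)"
proof -
  obtain h where "h ** g = mat 1" using Sp4_inverse[OF assms] by metis
  then show ?thesis by (metis matrix_left_invertible_injective)
qed

section \<open>Lagrangians as column spans and as graphs of symmetric matrices\<close>

lemma span_columns: "span (columns F) = range ((*v) (F :: real^'n^'m))"
proof
  show "span (columns F) \<subseteq> range ((*v) F)"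
    by (rule span_minimal) (auto simp: columns_image_basis subspace_UNIV
        intro!: linear_subspace_image)
  show "range ((*v) F) \<subseteq> span (columns F)"
    by (auto simp: matrix_vector_mult_in_columnspace)
qed

definition frame :: "real^2^2 \<Rightarrow> real^2^2 \<Rightarrow> real^2^4" where
  "frame S T = vector [S $ 1, S $ 2, T $ 1, T $ 2]"

lemma frame_nth [simp]:
  "frame S T $ 1 = S $ 1" "frame S T $ 2 = S $ 2" "frame S T $ 3 = T $ 1" "frame S T $ 4 = T $ 2"
  by (simp_all add: frame_def)

lemma frame_mult [simp]: "frame S T *v x = vec4 (S *v x) (T *v x)"
  by (simp add: vec_eq_iff forall_4 matrix_vector_mult_def)

lemma lag_mat_columns: "lag_mat X = span (columns (frame X (mat 1)))"
proof -
  have "frame X (mat 1) = vector [X $ 1, X $ 2, axis 1 1, axis 2 1]"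
    by (simp add: vec_eq_iff forall_4 forall_2 mat_def axis_def)
  then show ?thesis by (simp add: lag_mat_def)
qed

lemma lag_mat_eq: "lag_mat X = range (\<lambda>x. vec4 (X *v x) x)"
  by (simp add: lag_mat_columns span_columns)

lemma lag_inf_eq: "lag_inf = range (\<lambda>x. vec4 x 0)"
proof -
  have "axis 1 1 = vec4 (axis 1 1) 0" "axis 2 1 = vec4 (axis 2 1) 0"
    by (simp_all add: vec_eq_iff forall_4 axis_def)
  moreover have "span {vec4 (axis 1 1) 0, vec4 (axis 2 1) 0} = range (\<lambda>x. vec4 x 0)"
  proof (intro subset_antisym subsetI)
    fix v assume "v \<in> span {vec4 (axis 1 1) 0, vec4 (axis 2 1) 0}"
    then show "v \<in> range (\<lambda>x. vec4 x 0)"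
      by (auto simp: span_insert vec4_arith diff_eq_eq)
  next
    fix v assume "v \<in> range (\<lambda>x. vec4 x 0)"
    then obtain x where "v = vec4 x 0" by blast
    then have "v = (x $ 1) *\<^sub>R vec4 (axis 1 1) 0 + (x $ 2) *\<^sub>R vec4 (axis 2 1) 0"
      by (simp add: vec_eq_iff forall_4 axis_def)
    then show "v \<in> span {vec4 (axis 1 1) 0, vec4 (axis 2 1) 0}"
      by (simp add: span_add span_scale span_base)
  qed
  ultimately show ?thesis by (simp add: lag_inf_def)
qed

lemma lag_inf_columns: "lag_inf = span (columns (frame (mat 1) 0))"
  by (simp add: lag_inf_eq span_columns)

lemma dim_range_injective:
  assumes "inj ((*v) (F :: real^2^4))" shows "dim (range ((*v) F)) = 2"
  using full_rank_injective[of F] assms by (simp add: rank_dim_range)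

lemma inj_frame [simp]: "inj ((*v) (frame X (mat 1)))" "inj ((*v) (frame (mat 1) 0))"
  by (auto intro!: injI)

lemma lagrangian_lag_inf [simp]: "lagrangian lag_inf"
proof -
  have "dim lag_inf = 2" using dim_range_injective[OF inj_frame(2)] by (simp add: lag_inf_eq)
  moreover have "subspace lag_inf" by (simp add: lag_inf_def)
  ultimately show ?thesis by (auto simp: lagrangian_altdef lag_inf_eq)
qed

lemma symmetric_inner:
  fixes S :: "real^'n^'n" assumes "transpose S = S" shows "(S *v x) \<bullet> y = x \<bullet> (S *v y)"
  using assms by (metis dot_lmul_matrix transpose_matrix_vector)

lemma lagrangian_lag_mat [simp]: assumes "transpose S = S" shows "lagrangian (lag_mat S)"
proof -
  have "dim (lag_mat S) = 2" using dim_range_injective[OF inj_frame(1)] by (simp add: lag_mat_eq)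
  moreover have "subspace (lag_mat S)" by (simp add: lag_mat_def)
  ultimately show ?thesis
    by (auto simp: lagrangian_altdef lag_mat_eq symmetric_inner[OF assms])
qed

text \<open>\<open>lag_inf\<close> is the kernel of the projection to the last two coordinates, so
  transversality makes that projection an isomorphism on \<open>l\<close>. Hence \<open>l\<close> is
  the graph of a linear map, and isotropy of \<open>l\<close> is the symmetry of its matrix.\<close>

lemma lagrangian_graph:
  assumes l: "lagrangian l" and t: "transverse l lag_inf"
  obtains S where "transpose S = S" "l = lag_mat S"
proof -
  define dn :: "real^4 \<Rightarrow> real^2" where "dn = (\<lambda>v. vector [v $ 3, v $ 4])"
  have dn [simp]: "dn (vec4 x y) = y" for x y
    by (simp add: dn_def vec_eq_iff forall_2)
  have lin: "linear dn" 
    by (auto intro!: linearI simp: dn_def vec_eq_iff forall_2)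
  have sub: "subspace l" and dim: "dim l = 2" and iso: "\<And>v w. v \<in> l \<Longrightarrow> w \<in> l \<Longrightarrow> sform v w = 0"
    using l by (auto simp: lagrangian_altdef)
  have "inj_on dn l"
  proof (rule linear_inj_on_iff_eq_0[OF lin sub, THEN iffD2], intro ballI impI)
    fix v assume v: "v \<in> l" "dn v = 0"
    then obtain x where "v = vec4 x 0" by (metis dn vec4_cases)
    then have "v \<in> l \<inter> lag_inf" using v by (auto simp: lag_inf_eq)
    with t show "v = 0" by (simp add: transverse_def)
  qed
  then have "dim (dn ` l) = 2"
    using dim_image_eq[OF lin, of l] dim sub by (simp add: span_eq_iff[THEN iffD2])
  then have "span (dn ` l) = UNIV"
    by (simp flip: dim_eq_full)
  then have "dn ` l = UNIV"
    using linear_subspace_image[OF lin sub] by (metis span_eq_iff)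
  then obtain v1 v2 where v: "v1 \<in> l" "dn v1 = axis 1 1" "v2 \<in> l" "dn v2 = axis 2 1"
    by (metis UNIV_I imageE)
  obtain a1 a2 where a: "v1 = vec4 a1 (axis 1 1)" "v2 = vec4 a2 (axis 2 1)"
    using v(2,4) by (metis dn vec4_cases)
  \<comment> \<open>The columns are the upper halves of the lifts of the two basis vectors.\<close>
  define S :: "real^2^2" where "S = vector [vector [a1 $ 1, a2 $ 1], vector [a1 $ 2, a2 $ 2]]"
  have "sform v1 v2 = 0" using iso v by blast
  then have "a1 $ 2 = a2 $ 1"
    by (simp add: a inner_axis inner_axis')
  then have S: "transpose S = S"
    by (simp add: S_def transpose_def vec_eq_iff forall_2)
  have "lag_mat S \<subseteq> l"
  proof
    fix v assume "v \<in> lag_mat S"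
    then obtain x where "v = vec4 (S *v x) x" by (auto simp: lag_mat_eq)
    then have "v = x $ 1 *\<^sub>R v1 + x $ 2 *\<^sub>R v2"
      by (simp add: a S_def vec_eq_iff forall_4 axis_def matrix_vector_mult_def sum_2)
    then show "v \<in> l" using v sub by (simp add: subspace_add subspace_scale)
  qed
  then have "lag_mat S = l"
    using sub dim lagrangian_lag_mat[OF S]
    by (intro subspace_dim_equal) (auto simp: lagrangian_altdef)
  with S that show ?thesis by blast
qed

section \<open>Maximal triples and the sign of the Maslov form\<close>

lemma lagrangian_image:
  assumes g: "g \<in> carrier Sp4" and l: "lagrangian l"
  shows "lagrangian ((*v) g ` l)"
proof -
  have "dim ((*v) g ` l) = dim l"
    using Sp4_inj[OF g] by (intro dim_image_eq) (auto intro: inj_on_subset)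
  then show ?thesis
    using l g by (auto simp: lagrangian_altdef carrier_Sp4_iff intro!: linear_subspace_image)
qed

lemma transverse_image:
  assumes g: "g \<in> carrier Sp4" and l: "transverse l l'"
  shows "transverse ((*v) g ` l) ((*v) g ` l')"
  using l Sp4_inj[OF g] by (auto simp: transverse_def simp flip: image_Int)

lemma Sp4_image_mult: "(*v) (g ** h) ` l = (*v) g ` (*v) (h :: real^4^4) ` l"
  by (simp add: image_image matrix_vector_mul_assoc)

lemma maximal_triple_image:
  assumes g: "g \<in> carrier Sp4" and m: "maximal_triple l1 l2 l3"
  shows "maximal_triple ((*v) g ` l1) ((*v) g ` l2) ((*v) g ` l3)"
proof -
  obtain h where "h \<in> carrier Sp4" "l1 = (*v) h ` lag_inf" "l2 = (*v) h ` lag_mat 0"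
    "l3 = (*v) h ` lag_mat (mat 1)"
    using m by (auto simp: maximal_triple_def)
  then have "\<exists>k\<in>carrier Sp4. (*v) g ` l1 = (*v) k ` lag_inf \<and> (*v) g ` l2 = (*v) k ` lag_mat 0 \<and>
        (*v) g ` l3 = (*v) k ` lag_mat (mat 1)"
    using Sp4_mult[OF g] by (intro bexI[of _ "g ** h"]) (auto simp: Sp4_image_mult)
  with m g show ?thesis
    by (simp add: maximal_triple_def lagrangian_image transverse_image)
qed

text \<open>The negativity of this form is the Maslov index description of maximality.\<close>

definition maslov_neg :: "(real^4) set \<Rightarrow> (real^4) set \<Rightarrow> (real^4) set \<Rightarrow> bool" where
  "maslov_neg l1 l2 l3 \<longleftrightarrow> (\<forall>v\<in>l1. \<forall>w\<in>l3. v + w \<in> l2 \<longrightarrow> v + w \<noteq> 0 \<longrightarrow> sform v w < 0)"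

text \<open>The condition is invariant under \<open>Sp4\<close>. In the model triple, v = (a, 0) and
  w = (b, b) have their sum in \<open>lag_mat 0\<close> only if a = -b, and then the form is minus
  the squared norm of b.\<close>

lemma maximal_triple_imp_maslov_neg:
  assumes "maximal_triple l1 l2 l3" shows "maslov_neg l1 l2 l3"
  unfolding maslov_neg_def
proof (intro ballI impI)
  fix v w assume vw: "v \<in> l1" "w \<in> l3" "v + w \<in> l2" "v + w \<noteq> 0"
  obtain g where g: "g \<in> carrier Sp4" "l1 = (*v) g ` lag_inf" "l2 = (*v) g ` lag_mat 0"
    "l3 = (*v) g ` lag_mat (mat 1)"
    using assms by (auto simp: maximal_triple_def)
  obtain a b c where v: "v = g *v vec4 a 0" and w: "w = g *v vec4 b b" and u: "v + w = g *v vec4 0 c"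
    using vw g by (auto simp: lag_inf_eq lag_mat_eq)
  have "g *v (vec4 a 0 + vec4 b b) = g *v vec4 0 c"
    using u v w by (simp add: matrix_vector_right_distrib)
  then have "vec4 a 0 + vec4 b b = vec4 0 c"
    using Sp4_inj[OF g(1)] by (simp add: inj_eq)
  then have "a + b = 0" and bc: "b = c" by (auto simp: vec4_arith)
  then have ab: "a = - b" by (simp only: eq_neg_iff_add_eq_0)
  with u vw bc have "b \<noteq> 0" by auto
  then show "sform v w < 0" using g(1) by (simp add: v w ab carrier_Sp4_iff)
qed

lemma lagrangian_decomp:
  assumes "lagrangian l" "lagrangian l'" "transverse l l'"
  shows "\<exists>v\<in>l. \<exists>w\<in>l'. u = v + w"
proof -
  have s: "subspace l" "subspace l'" "dim l = 2" "dim l' = 2"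
    using assms by (auto simp: lagrangian_def)
  have "l \<inter> l' = {0}" using assms by (simp add: transverse_def)
  then have "dim {x + y |x y. x \<in> l \<and> y \<in> l'} = 4"
    using dim_sums_Int[OF s(1,2)] s by simp
  then have "span {x + y |x y. x \<in> l \<and> y \<in> l'} = UNIV"
    by (simp flip: dim_eq_full)
  then have "{x + y |x y. x \<in> l \<and> y \<in> l'} = UNIV"
    unfolding span_eq_iff[THEN iffD2, OF subspace_sums[OF s(1,2)]] .
  then have "u \<in> {x + y |x y. x \<in> l \<and> y \<in> l'}" by auto
  then show ?thesis by auto
qed

text \<open>Splitting a vector of \<open>l2\<close> as v + w with v in \<open>l1\<close> and w in
  \<open>l3\<close>, the value \<open>sform v w\<close> is a negative definite quadratic form on
  \<open>l2\<close>. Gram-Schmidt gives a basis e1 + e3, f1 + f3 of \<open>l2\<close> that is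
  orthonormal for its negative, and the components of these vectors assemble into a symplectic
  basis.\<close>

lemma maslov_neg_imp_maximal_triple:
  assumes l: "lagrangian l1" "lagrangian l2" "lagrangian l3"
    and t: "transverse l1 l2" "transverse l1 l3" "transverse l2 l3"
    and neg: "maslov_neg l1 l2 l3"
  shows "maximal_triple l1 l2 l3"
proof -
  have s: "subspace l1" "subspace l2" "subspace l3" and d: "dim l1 = 2" "dim l2 = 2" "dim l3 = 2"
    and iso: "\<And>v w. v \<in> l1 \<Longrightarrow> w \<in> l1 \<Longrightarrow> sform v w = 0"
      "\<And>v w. v \<in> l2 \<Longrightarrow> w \<in> l2 \<Longrightarrow> sform v w = 0" "\<And>v w. v \<in> l3 \<Longrightarrow> w \<in> l3 \<Longrightarrow> sform v w = 0"
    using l by (auto simp: lagrangian_altdef)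
  have normalise: "\<exists>c a b. c \<noteq> 0 \<and> a \<in> l1 \<and> b \<in> l3 \<and> c *\<^sub>R (v + w) = a + b \<and> sform a b = -1 \<and>
      a = c *\<^sub>R v \<and> b = c *\<^sub>R w"
    if "v \<in> l1" "w \<in> l3" "v + w \<in> l2" "v + w \<noteq> 0" for v w
  proof -
    have neg': "sform v w < 0" using neg that by (auto simp: maslov_neg_def)
    define c where "c = 1 / sqrt (- sform v w)"
    have "c \<noteq> 0" "c * (c * sform v w) = -1"
      using neg' by (auto simp: c_def field_simps)
    then show ?thesis
      using that s by (intro exI[of _ c] exI[of _ "c *\<^sub>R v"] exI[of _ "c *\<^sub>R w"])
        (auto simp: sform_bilinear algebra_simps subspace_scale)
  qed
  obtain e0 where e0: "e0 \<in> l2" "e0 \<noteq> 0"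
    using d(2) by (metis dim_eq_0 subsetI singletonI singleton_iff zero_neq_numeral)
  obtain v0 w0 where e0': "v0 \<in> l1" "w0 \<in> l3" "e0 = v0 + w0"
    using lagrangian_decomp[OF l(1,3) t(2)] by blast
  obtain c e1 e3 where e: "e1 \<in> l1" "e3 \<in> l3" "c *\<^sub>R (v0 + w0) = e1 + e3" "sform e1 e3 = -1"
    using normalise[of v0 w0] e0 e0' by blast
  have e2: "e1 + e3 \<in> l2" unfolding e(3)[symmetric] using e0 e0' s by (simp add: subspace_scale)
  have "dim {e1 + e3} \<le> 1" by (simp add: dim_le_card')
  then have "\<not> l2 \<subseteq> span {e1 + e3}"
    using d(2) dim_subset[of l2 "span {e1 + e3}"] by auto
  then obtain f0 where f0: "f0 \<in> l2" "f0 \<notin> span {e1 + e3}" by auto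
  obtain v w where vw: "v \<in> l1" "w \<in> l3" "f0 = v + w"
    using lagrangian_decomp[OF l(1,3) t(2)] by blast
  \<comment> \<open>The polar form between the two vectors. Isotropy of \<open>l2\<close> makes it
    symmetric, so \<open>sform v e3\<close> has the same value. As e1 + e3 has value -1, adding b
    times it is the orthogonal projection step.\<close>
  define b where "b = sform e1 w"
  have "sform (e1 + e3) (v + w) = 0" using iso e2 f0 vw by blast
  then have b': "sform v e3 = b"
    using iso(1)[OF e(1) vw(1)] iso(3)[OF e(2) vw(2)] sform_skew[of e3 v]
    by (simp add: sform_bilinear b_def)
  define v' w' where "v' = v + b *\<^sub>R e1" and "w' = w + b *\<^sub>R e3"
  have v'w': "v' \<in> l1" "w' \<in> l3"
    using vw e s by (auto simp: v'_def w'_def subspace_add subspace_scale)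
  have sum: "v' + w' = f0 + b *\<^sub>R (e1 + e3)" by (simp add: v'_def w'_def vw algebra_simps)
  have sum2: "v' + w' \<in> l2" unfolding sum using f0 e2 s by (simp add: subspace_add subspace_scale)
  have "v' + w' \<noteq> 0"
  proof
    assume "v' + w' = 0"
    then have "f0 = (- b) *\<^sub>R (e1 + e3)" unfolding sum by (simp add: eq_neg_iff_add_eq_0)
    then have "f0 \<in> span {e1 + e3}" by (metis span_scale span_base singletonI)
    with f0 show False by blast
  qed
  then obtain k f1 f3 where f: "f1 \<in> l1" "f3 \<in> l3" "k *\<^sub>R (v' + w') = f1 + f3" "sform f1 f3 = -1"
    "f1 = k *\<^sub>R v'" "f3 = k *\<^sub>R w'"
    using normalise[OF v'w' sum2] by blast
  have f2: "f1 + f3 \<in> l2" unfolding f(3)[symmetric] using sum2 s by (simp add: subspace_scale)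
  have "sform e1 w' = 0" "sform v' e3 = 0"
    by (simp_all add: v'_def w'_def sform_bilinear e(4) b') (simp add: b_def)
  then have o: "sform e1 f3 = 0" "sform f1 e3 = 0" by (simp_all add: f(5,6) sform_bilinear)
  have z: "sform e1 f1 = 0" "sform f1 e1 = 0" "sform e3 f3 = 0" "sform f3 e3 = 0"
    using iso e f by blast+
  \<comment> \<open>The minus signs make the pairing of -e1 with e1 + e3 equal to 1, and they let
    the diagonal vectors (x, x) land in \<open>l3\<close>, because -e1 + (e1 + e3) = e3.\<close>
  define g :: "real^4^4" where "g = transpose (vector [- e1, - f1, e1 + e3, f1 + f3])"
  have g: "g *v vec4 x y = - (x $ 1 *\<^sub>R e1) - x $ 2 *\<^sub>R f1 + y $ 1 *\<^sub>R (e1 + e3) + y $ 2 *\<^sub>R (f1 + f3)" for x y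
    by (simp add: g_def vec_eq_iff matrix_vector_mult_def sum_4 transpose_def algebra_simps)
  have "sform (g *v vec4 x y) (g *v vec4 x' y') = x \<bullet> y' - y \<bullet> x'" for x y x' y'
    unfolding g using o z e(4) f(4) sform_skew[of e3 e1] sform_skew[of f3 f1] sform_skew[of f3 e1]
      sform_skew[of e3 f1]
    by (simp add: sform_bilinear inner_vec_def sum_2 algebra_simps)
  then have gS: "g \<in> carrier Sp4"
    unfolding carrier_Sp4_iff by (metis sform_vec4 vec4_cases)
  have eqI: "(*v) g ` l = l'" if "lagrangian l" "lagrangian l'" "(*v) g ` l \<subseteq> l'" for l l'
    using lagrangian_image[OF gS that(1)] that(2,3)
    by (intro subspace_dim_equal) (auto simp: lagrangian_def)
  have "(*v) g ` lag_inf = l1"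
    using e(1) f(1) s
    by (intro eqI l lagrangian_lag_inf)
      (auto simp: lag_inf_eq g intro!: subspace_diff subspace_neg subspace_scale)
  moreover have "(*v) g ` lag_mat 0 = l2"
    using e2 f2 s
    by (intro eqI l lagrangian_lag_mat)
      (auto simp: lag_mat_eq g transpose_def vec_eq_iff simp del: scaleR_add_right
        intro!: subspace_add[of l2] subspace_scale[of l2])
  moreover have "(*v) g ` lag_mat (mat 1) = l3"
  proof (intro eqI l lagrangian_lag_mat)
    have "g *v vec4 x x = x $ 1 *\<^sub>R e3 + x $ 2 *\<^sub>R f3" for x
      by (simp add: g algebra_simps)
    then show "(*v) g ` lag_mat (mat 1) \<subseteq> l3"
      using e(2) f(2) s by (auto simp: lag_mat_eq intro!: subspace_add subspace_scale)
  qed (simp add: transpose_mat)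
  ultimately show ?thesis using l t gS by (auto simp: maximal_triple_def)
qed

section \<open>Maximality of graphs and the Loewner order\<close>

definition posdef :: "real^'n^'n \<Rightarrow> bool" where
  "posdef S \<longleftrightarrow> transpose S = S \<and> (\<forall>x. x \<noteq> 0 \<longrightarrow> 0 < x \<bullet> (S *v x))"

lemma transverse_lag_inf [simp]: "transverse (lag_mat S) lag_inf"
  by (auto simp: transverse_def lag_mat_eq lag_inf_eq)
     (auto simp: image_iff intro!: exI[of _ 0])

lemma transverse_lag_mat:
  assumes "posdef (T - S)" shows "transverse (lag_mat S) (lag_mat T)"
proof -
  have x: "x = 0" if "S *v x = T *v x" for x
    using assms that by (auto simp: posdef_def matrix_vector_mult_diff_rdistrib)
  have "lag_mat S \<inter> lag_mat T \<subseteq> {0}"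
    by (auto simp: lag_mat_eq dest!: x)
  moreover have "0 \<in> lag_mat S \<inter> lag_mat T"
    by (auto simp: lag_mat_eq image_iff intro!: exI[of _ 0])
  ultimately show ?thesis by (auto simp: transverse_def)
qed

text \<open>A point of the graph of \<open>T\<close> is a point (Sx, x) of the graph of
  \<open>S\<close> plus ((T - S)x, 0), and the Maslov form of this splitting is minus the quadratic
  form of \<open>T - S\<close> at x.\<close>

lemma maximal_triple_lag_inf:
  assumes "transpose S = S" "transpose T = T"
  shows "maximal_triple (lag_mat S) (lag_mat T) lag_inf \<longleftrightarrow> posdef (T - S)"
proof
  assume "maximal_triple (lag_mat S) (lag_mat T) lag_inf"
  then have neg: "maslov_neg (lag_mat S) (lag_mat T) lag_inf" by (rule maximal_triple_imp_maslov_neg)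
  have "0 < x \<bullet> ((T - S) *v x)" if "x \<noteq> 0" for x
  proof -
    have "sform (vec4 (S *v x) x) (vec4 ((T - S) *v x) 0) < 0"
      using neg that unfolding maslov_neg_def lag_mat_eq lag_inf_eq
      by (auto simp: vec4_arith matrix_vector_mult_diff_rdistrib)
    then show ?thesis by simp
  qed
  moreover have "transpose (T - S) = T - S"
    using assms by (simp add: transpose_def vec_eq_iff)
  ultimately show "posdef (T - S)" by (simp add: posdef_def)
next
  assume pd: "posdef (T - S)"
  have "maslov_neg (lag_mat S) (lag_mat T) lag_inf"
    unfolding maslov_neg_def
  proof (intro ballI impI)
    fix v w assume *: "v \<in> lag_mat S" "w \<in> lag_inf" "v + w \<in> lag_mat T" "v + w \<noteq> 0"
    then obtain x z where vw: "v = vec4 (S *v x) x" "w = vec4 z 0"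
      by (auto simp: lag_mat_eq lag_inf_eq)
    with * have "S *v x + z = T *v x" by (auto simp: lag_mat_eq vec4_arith)
    then have z: "z = (T - S) *v x"
      by (simp add: matrix_vector_mult_diff_rdistrib algebra_simps)
    then have "x \<noteq> 0" using *(4) vw by auto
    then show "sform v w < 0" using pd by (simp add: vw z posdef_def)
  qed
  then show "maximal_triple (lag_mat S) (lag_mat T) lag_inf"
    using assms pd by (intro maslov_neg_imp_maximal_triple) (auto simp: transverse_lag_mat)
qed

lemma posdef_add: "posdef S \<Longrightarrow> posdef T \<Longrightarrow> posdef (S + T)"
  by (auto simp: posdef_def matrix_vector_mult_add_rdistrib inner_add_right add_pos_pos)
     (simp add: transpose_def vec_eq_iff)

text \<open>If (Sy, y) + (Uz, z) lies on the graph of \<open>T\<close>, then (T - S)y = (U - T)z. By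
  this relation and the symmetry of T - S, the negated Maslov value y . (U - S)z becomes y . (T -
  S)y + z . (U - T)z, which is positive.\<close>

lemma maximal_triple_lag_mat:
  assumes sym: "transpose S = S" "transpose T = T" "transpose U = U"
    and pd: "posdef (T - S)" "posdef (U - T)"
  shows "maximal_triple (lag_mat S) (lag_mat T) (lag_mat U)"
proof -
  have "posdef (U - S)" using posdef_add[OF pd(2,1)] by simp
  moreover have "maslov_neg (lag_mat S) (lag_mat T) (lag_mat U)"
    unfolding maslov_neg_def
  proof (intro ballI impI)
    fix v w assume *: "v \<in> lag_mat S" "w \<in> lag_mat U" "v + w \<in> lag_mat T" "v + w \<noteq> 0"
    then obtain y z where vw: "v = vec4 (S *v y) y" "w = vec4 (U *v z) z" by (auto simp: lag_mat_eq)
    with * have eq: "S *v y + U *v z = T *v (y + z)" by (auto simp: lag_mat_eq vec4_arith)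
    then have eq': "(T - S) *v y = (U - T) *v z"
      by (simp add: matrix_vector_mult_diff_rdistrib matrix_vector_right_distrib algebra_simps)
    have nz: "y \<noteq> 0 \<or> z \<noteq> 0" using * vw by auto
    have "transpose (T - S) = T - S" using pd by (simp add: posdef_def)
    then have "y \<bullet> ((T - S) *v z) = z \<bullet> ((T - S) *v y)"
      by (metis symmetric_inner inner_commute)
    moreover have "y \<bullet> ((U - S) *v z) = y \<bullet> ((U - T) *v z) + y \<bullet> ((T - S) *v z)"
      by (simp add: matrix_vector_mult_diff_rdistrib inner_simps)
    ultimately have "y \<bullet> ((U - S) *v z) = y \<bullet> ((T - S) *v y) + z \<bullet> ((U - T) *v z)"
      by (simp add: eq')
    also have "\<dots> > 0"
      using pd nz unfolding posdef_def by (metis add_nonneg_pos add_pos_nonneg inner_zero_left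
          less_eq_real_def)
    finally have "0 < y \<bullet> ((U - S) *v z)" .
    then show "sform v w < 0"
      using symmetric_inner[OF sym(1), of y z]
      by (simp add: vw matrix_vector_mult_diff_rdistrib inner_simps inner_commute)
  qed
  ultimately show ?thesis
    using assms by (intro maslov_neg_imp_maximal_triple) (auto simp: transverse_lag_mat)
qed

section \<open>Genericity of quadruples\<close>

definition mat2 :: "real \<Rightarrow> real \<Rightarrow> real \<Rightarrow> real^2^2" where
  "mat2 p q r = vector [vector [p, q], vector [q, r]]"

lemma mat2_nth [simp]:
  "mat2 p q r $ 1 $ 1 = p" "mat2 p q r $ 1 $ 2 = q" "mat2 p q r $ 2 $ 1 = q" "mat2 p q r $ 2 $ 2 = r"
  by (simp_all add: mat2_def)

lemma transpose_mat2 [simp]: "transpose (mat2 p q r) = mat2 p q r"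
  by (simp add: transpose_def vec_eq_iff forall_2)

lemma mat2_cases: assumes "transpose S = S" obtains p q r where "S = mat2 p q r"
proof
  have "S $ 2 $ 1 = S $ 1 $ 2"
    by (subst assms[symmetric]) (simp add: transpose_def)
  then show "S = mat2 (S $ 1 $ 1) (S $ 1 $ 2) (S $ 2 $ 2)"
    by (simp add: vec_eq_iff forall_2)
qed

lemma mat2_eq_iff [simp]: "mat2 p q r = mat2 p' q' r' \<longleftrightarrow> p = p' \<and> q = q' \<and> r = r'"
  by (auto simp: vec_eq_iff forall_2)

lemma mat2_arith:
  "mat2 p q r + mat2 p' q' r' = mat2 (p + p') (q + q') (r + r')"
  "mat2 p q r - mat2 p' q' r' = mat2 (p - p') (q - q') (r - r')"
  "c *\<^sub>R mat2 p q r = mat2 (c * p) (c * q) (c * r)"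
  by (simp_all add: vec_eq_iff forall_2)

lemma mat_1_mat2: "mat 1 = mat2 1 0 1"
  by (simp add: vec_eq_iff forall_2 mat_def)

lemma det_mat2: "det (mat2 p q r) = p * r - q\<^sup>2"
  by (simp add: det_2 power2_eq_square)

lemma posdef_mat2: "posdef (mat2 p q r) \<longleftrightarrow> 0 < p \<and> 0 < p * r - q\<^sup>2"
proof -
  have val: "x \<bullet> (mat2 p q r *v x) = p * (x $ 1)\<^sup>2 + 2 * q * x $ 1 * x $ 2 + r * (x $ 2)\<^sup>2"
    for x :: "real^2"
    by (simp add: matrix_vector_mult_def inner_vec_def sum_2 power2_eq_square algebra_simps)
  show ?thesis
  proof
    assume "posdef (mat2 p q r)"
    then have *: "x \<noteq> 0 \<Longrightarrow> 0 < p * (x $ 1)\<^sup>2 + 2 * q * x $ 1 * x $ 2 + r * (x $ 2)\<^sup>2"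
      for x :: "real^2"
      by (simp add: posdef_def val)
    have "0 < p" using *[of "axis 1 1"] by (simp add: axis_def vec_eq_iff)
    moreover have "0 < p * (p * r - q\<^sup>2)"
      \<comment> \<open>This vector is orthogonal to the second row up to the determinant: the form
        takes the value p times the determinant there.\<close>
      using *[of "vector [- q, p]"] \<open>0 < p\<close>
      by (simp add: vec_eq_iff forall_2 power2_eq_square algebra_simps)
    ultimately show "0 < p \<and> 0 < p * r - q\<^sup>2" by (simp add: zero_less_mult_iff)
  next
    assume *: "0 < p \<and> 0 < p * r - q\<^sup>2"
    have "0 < p * (x $ 1)\<^sup>2 + 2 * q * x $ 1 * x $ 2 + r * (x $ 2)\<^sup>2" if "x \<noteq> 0" for x :: "real^2"
    proof -
      have "p * (p * (x $ 1)\<^sup>2 + 2 * q * x $ 1 * x $ 2 + r * (x $ 2)\<^sup>2) =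
          (p * x $ 1 + q * x $ 2)\<^sup>2 + (p * r - q\<^sup>2) * (x $ 2)\<^sup>2"
        by (simp add: power2_eq_square algebra_simps)
      also have "\<dots> > 0"
      proof (cases "x $ 2 = 0")
        case True
        with that have "x $ 1 \<noteq> 0" by (auto simp: vec_eq_iff forall_2)
        with True * show ?thesis by simp
      qed (use * in \<open>simp add: add_nonneg_pos\<close>)
      finally show ?thesis using * by (simp add: zero_less_mult_iff)
    qed
    then show "posdef (mat2 p q r)" by (simp add: posdef_def val)
  qed
qed

lemma posdef_scale: "0 < c \<Longrightarrow> posdef (c *\<^sub>R S) \<longleftrightarrow> posdef S"
  by (simp add: posdef_def zero_less_mult_iff transpose_scalar flip: scaleR_matrix_vector_assoc)

text \<open>The discriminant of det (Y - c X) as a polynomial in c, whose middle coefficient is a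
  polarised determinant. For invertible \<open>X\<close> it is det X squared times the discriminant
  of the characteristic polynomial of the inverse of X times Y, but it is polynomial in the
  entries.\<close>

definition disc :: "real^2^2 \<Rightarrow> real^2^2 \<Rightarrow> real" where
  "disc X Y = (det (X + Y) - det X - det Y)\<^sup>2 - 4 * det X * det Y"

lemma disc_mat2:
  "disc (mat2 p q r) (mat2 p' q' r') = (p * r' + r * p' - 2 * q * q')\<^sup>2 -
     4 * (p * r - q\<^sup>2) * (p' * r' - q'\<^sup>2)"
  by (simp add: disc_def mat2_arith det_mat2) (simp add: power2_eq_square algebra_simps)

lemma disc_scale: "disc (a *\<^sub>R X) (b *\<^sub>R Y) = (a * b)\<^sup>2 * disc X Y"
  by (simp add: disc_def det_2 power2_eq_square algebra_simps)

text \<open>A pencil with a positive definite member and a double eigenvalue is scalar. The factor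
  is the quotient of the first diagonal entries and exceeds 1 because \<open>Y - X\<close> is
  positive definite.\<close>

lemma disc_zero_imp_proportional:
  assumes X: "posdef X" and Y: "posdef (Y - X)" and d: "disc X Y = 0"
  obtains c where "1 < c" "Y = c *\<^sub>R X"
proof -
  obtain p q r where X': "X = mat2 p q r" using X by (metis mat2_cases posdef_def)
  have "transpose (Y - X) = Y - X" using Y by (simp add: posdef_def)
  then obtain p1 q1 r1 where "Y - X = mat2 p1 q1 r1" using mat2_cases by metis
  then have "Y = mat2 p1 q1 r1 + X" by (simp add: diff_eq_eq)
  then obtain p' q' r' where Y': "Y = mat2 p' q' r'" by (metis X' mat2_arith(1))
  have pos: "0 < p" "0 < p * r - q\<^sup>2" "p < p'"
    using X Y by (simp_all add: X' Y' posdef_mat2 mat2_arith)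
  \<comment> \<open>Adding a multiple of \<open>X\<close> to \<open>Y\<close> does not change the
    discriminant. Subtracting p'/p times \<open>X\<close> clears the first entry of
    \<open>Y\<close>; what remains is a sum of two squares, the second weighted by 4 det X.\<close>
  have "p\<^sup>2 * disc X Y = (p * (p * r' - r * p') - 2 * q * (p * q' - q * p'))\<^sup>2 +
      4 * (p * r - q\<^sup>2) * (p * q' - q * p')\<^sup>2"
    by (simp add: X' Y' disc_mat2) (simp add: power2_eq_square algebra_simps)
  with d have "(p * (p * r' - r * p') - 2 * q * (p * q' - q * p'))\<^sup>2 +
      4 * (p * r - q\<^sup>2) * (p * q' - q * p')\<^sup>2 = 0" by simp
  moreover have "0 \<le> 4 * (p * r - q\<^sup>2) * (p * q' - q * p')\<^sup>2"
    using pos by simp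
  ultimately have "(p * (p * r' - r * p') - 2 * q * (p * q' - q * p'))\<^sup>2 = 0 \<and>
      4 * (p * r - q\<^sup>2) * (p * q' - q * p')\<^sup>2 = 0"
    by (metis add_nonneg_eq_0_iff zero_le_power2)
  then have "p * q' = q * p'" "p * r' = r * p'" using pos by auto
  then have "Y = (p' / p) *\<^sub>R X" using pos by (simp add: X' Y' mat2_arith field_simps)
  moreover have "1 < p' / p" using pos by simp
  ultimately show ?thesis using that by blast
qed

lemma card_quadratic_roots:
  fixes a b c :: real
  assumes "0 < a"
  shows "card {x. a * x\<^sup>2 - b * x + c = 0} = 2 \<longleftrightarrow> 0 < b\<^sup>2 - 4 * a * c"
    and "card {x. a * x\<^sup>2 - b * x + c = 0} = 1 \<longleftrightarrow> b\<^sup>2 - 4 * a * c = 0"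
proof -
  let ?D = "b\<^sup>2 - 4 * a * c" and ?R = "{x. a * x\<^sup>2 - b * x + c = 0}"
  have "4 * a * (a * x\<^sup>2 - b * x + c) = (2 * a * x - b)\<^sup>2 - ?D" for x
    by (simp add: power2_eq_square algebra_simps)
  then have root: "a * x\<^sup>2 - b * x + c = 0 \<longleftrightarrow> (2 * a * x - b)\<^sup>2 = ?D" for x
    using assms mult_eq_0_iff[of "4 * a" "a * x\<^sup>2 - b * x + c"] by auto
  have neg: "?R = {}" if "?D < 0"
    unfolding root using that by (smt (verit) Collect_empty_eq zero_le_power2)
  have zero: "?R = {b / (2 * a)}" if "?D = 0"
    unfolding root that using assms by (auto simp: field_simps)
  have pos: "?R = {(b + sqrt ?D) / (2 * a), (b - sqrt ?D) / (2 * a)}" if "?D > 0"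
  proof -
    have "(2 * a * x - b)\<^sup>2 = ?D \<longleftrightarrow> 2 * a * x - b = sqrt ?D \<or> 2 * a * x - b = - sqrt ?D" for x
      using that power2_eq_iff[of "2 * a * x - b" "sqrt ?D"] by simp
    then have "?R = {x. 2 * a * x - b = sqrt ?D \<or> 2 * a * x - b = - sqrt ?D}"
      unfolding root by simp
    then show ?thesis using assms by (simp add: set_eq_iff field_simps)
  qed
  have "card ?R = 2" if "?D > 0"
    unfolding pos[OF that] using assms that by (simp add: card_2_iff')  
  then show "card ?R = 2 \<longleftrightarrow> 0 < ?D" "card ?R = 1 \<longleftrightarrow> ?D = 0"
    using neg zero by (cases "?D < 0"; cases "?D = 0"; force)+
qed

section \<open>Eigenvalues of cross-ratios\<close>

lemma proj_par_eqI:
  assumes l: "lagrangian l" "lagrangian l'" "transverse l l'" and u: "u \<in> l" "v - u \<in> l'"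
  shows "proj_par l l' v = u"
  unfolding proj_par_def
proof (rule the_equality)
  fix u' assume u': "u' \<in> l \<and> v - u' \<in> l'"
  have s: "subspace l" "subspace l'" using l by (auto simp: lagrangian_def)
  have "u' - u \<in> l" "(v - u) - (v - u') \<in> l'"
    using u u' s by (blast intro: subspace_diff)+
  then have "u' - u \<in> l \<inter> l'" by simp
  then have "u' - u \<in> {0}" using l(3) by (simp only: transverse_def)
  then show "u' = u" by simp
qed (use u in simp)

text \<open>Removes the definite descriptions hidden in \<open>proj_par\<close>: u is the projection
  of v to \<open>l4\<close> along \<open>l3\<close>, and the last membership says that its
  \<open>l1\<close> component is c times v.\<close>

lemma eigenvalues_on_cross_ratio:
  assumes l: "lagrangian l1" "lagrangian l2" "lagrangian l3" "lagrangian l4"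
    and t: "transverse l1 l2" "transverse l4 l3"
  shows "eigenvalues_on l1 (cross_ratio l1 l2 l3 l4) =
    {c. \<exists>v\<in>l1. v \<noteq> 0 \<and> (\<exists>u\<in>l4. v - u \<in> l3 \<and> u - c *\<^sub>R v \<in> l2)}"
proof -
  have "cross_ratio l1 l2 l3 l4 v = c *\<^sub>R v \<longleftrightarrow> (\<exists>u\<in>l4. v - u \<in> l3 \<and> u - c *\<^sub>R v \<in> l2)"
    if v: "v \<in> l1" for v c
  proof -
    obtain u w where u: "u \<in> l4" "w \<in> l3" "v = u + w"
      using lagrangian_decomp[OF l(4,3) t(2)] by blast
    then have pu: "proj_par l4 l3 v = u" by (intro proj_par_eqI l t) auto
    obtain x y where x: "x \<in> l1" "y \<in> l2" "u = x + y"
      using lagrangian_decomp[OF l(1,2) t(1)] by blast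
    then have px: "proj_par l1 l2 u = x" by (intro proj_par_eqI l t) auto
    have cv: "c *\<^sub>R v \<in> l1" using v l by (simp add: lagrangian_def subspace_scale)
    show ?thesis
    proof
      assume "cross_ratio l1 l2 l3 l4 v = c *\<^sub>R v"
      then have "x = c *\<^sub>R v" by (simp add: cross_ratio_def pu px)
      then show "\<exists>u\<in>l4. v - u \<in> l3 \<and> u - c *\<^sub>R v \<in> l2"
        using u x by (intro bexI[of _ u]) auto
    next
      assume "\<exists>u\<in>l4. v - u \<in> l3 \<and> u - c *\<^sub>R v \<in> l2"
      then obtain u' where u': "u' \<in> l4" "v - u' \<in> l3" "u' - c *\<^sub>R v \<in> l2" by blast
      then have "u' = u" using proj_par_eqI[OF l(4,3) t(2) u'(1,2)] pu by simp
      then show "cross_ratio l1 l2 l3 l4 v = c *\<^sub>R v"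
        using proj_par_eqI[OF l(1,2) t(1) cv] u' by (simp add: cross_ratio_def pu)
    qed
  qed
  then show ?thesis unfolding eigenvalues_on_def by auto
qed

lemma maximal_nth:
  "maximal ls \<Longrightarrow> i < j \<Longrightarrow> j < k \<Longrightarrow> k < length ls \<Longrightarrow>
    maximal_triple (ls ! i) (ls ! j) (ls ! k)"
  by (simp add: maximal_def)

lemma maximal_image:
  assumes "g \<in> carrier Sp4" "maximal ls" shows "maximal (map ((`) ((*v) g)) ls)"
  using assms by (auto simp: maximal_def maximal_triple_image)

lemma maximal_lag_mat:
  assumes sym: "\<forall>S\<in>set Ss. transpose S = S" and sorted: "sorted_wrt (\<lambda>S T. posdef (T - S)) Ss"
  shows "maximal (map lag_mat Ss @ [lag_inf])"
  unfolding maximal_def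
proof (intro allI impI)
  fix i j k assume *: "i < j \<and> j < k \<and> k < length (map lag_mat Ss @ [lag_inf])"
  have pd: "posdef (Ss ! j - Ss ! i)" if "i < j" "j < length Ss" for i j
    using sorted that by (simp add: sorted_wrt_iff_nth_less)
  have sy: "transpose (Ss ! i) = Ss ! i" if "i < length Ss" for i
    using sym that by simp
  show "maximal_triple ((map lag_mat Ss @ [lag_inf]) ! i) ((map lag_mat Ss @ [lag_inf]) ! j)
      ((map lag_mat Ss @ [lag_inf]) ! k)"
  proof (cases "k < length Ss")
    case True
    with * show ?thesis by (simp add: nth_append pd sy maximal_triple_lag_mat)
  next
    case False
    with * have "k = length Ss" by simp
    with * show ?thesis by (simp add: nth_append pd sy maximal_triple_lag_inf)
  qed
qed

lemma transpose_zero [simp]: "transpose (0 :: real^'n^'m) = 0"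
  by (simp add: transpose_def vec_eq_iff)

lemma maximal_lag_quadruple:
  assumes "g \<in> carrier Sp4" "posdef X" "posdef (Y - X)"
  shows "maximal [(*v) g ` lag_mat 0, (*v) g ` lag_mat X, (*v) g ` lag_mat Y, (*v) g ` lag_inf]"
proof -
  have "posdef Y" using posdef_add[OF assms(2,3)] by simp
  have "maximal (map lag_mat [0, X, Y] @ [lag_inf])"
    using assms \<open>posdef Y\<close> by (intro maximal_lag_mat) (auto simp: posdef_def)
  from maximal_image[OF assms(1) this] show ?thesis by simp
qed

lemma exists_kernel_iff_det:
  fixes A :: "real^'n^'n" shows "(\<exists>x. x \<noteq> 0 \<and> A *v x = 0) \<longleftrightarrow> det A = 0"
  using invertible_det_nz[of A] matrix_left_invertible_ker[of A] invertible_left_inverse[of A] by blast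

lemma eigenvalues_on_lag_quadruple:
  assumes g: "g \<in> carrier Sp4" and X: "posdef X" "posdef (Y - X)"
  shows "eigenvalues_on ((*v) g ` lag_mat 0) (cross_ratio ((*v) g ` lag_mat 0)
      ((*v) g ` lag_mat X) ((*v) g ` lag_mat Y) ((*v) g ` lag_inf)) =
    {c. det X * c\<^sup>2 - (det (X + Y) - det X - det Y) * c + det Y = 0}"
proof -
  have "maximal_triple ((*v) g ` lag_mat 0) ((*v) g ` lag_mat X) ((*v) g ` lag_mat Y)"
       "maximal_triple ((*v) g ` lag_mat X) ((*v) g ` lag_mat Y) ((*v) g ` lag_inf)"
    using maximal_nth[OF maximal_lag_quadruple[OF assms], of 0 1 2]
      maximal_nth[OF maximal_lag_quadruple[OF assms], of 1 2 3] by simp_all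
  then have l: "lagrangian ((*v) g ` lag_mat 0)" "lagrangian ((*v) g ` lag_mat X)"
      "lagrangian ((*v) g ` lag_mat Y)" "lagrangian ((*v) g ` lag_inf)"
      "transverse ((*v) g ` lag_mat 0) ((*v) g ` lag_mat X)"
      "transverse ((*v) g ` lag_inf) ((*v) g ` lag_mat Y)"
    by (auto simp: maximal_triple_def transverse_def)
  have inj: "g *v x = g *v y \<longleftrightarrow> x = y" for x y using Sp4_inj[OF g] by (simp add: inj_eq)
  have z: "g *v x = 0 \<longleftrightarrow> x = 0" for x using inj[of x 0] by simp
  have mem: "g *v x \<in> (*v) g ` l \<longleftrightarrow> x \<in> l" for x l
    using Sp4_inj[OF g] by (rule inj_image_mem_iff)
  have mem2: "g *v x - g *v y \<in> (*v) g ` l \<longleftrightarrow> x - y \<in> l"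
    "g *v x - c *\<^sub>R (g *v y) \<in> (*v) g ` l \<longleftrightarrow> x - c *\<^sub>R y \<in> l" for x y l c
    using mem[of "x - y" l] mem[of "x - c *\<^sub>R y" l]
    unfolding matrix_vector_mult_diff_distrib matrix_vector_mult_scaleR .
  have "(\<exists>v\<in>(*v) g ` lag_mat 0. v \<noteq> 0 \<and> (\<exists>u\<in>(*v) g ` lag_inf. v - u \<in> (*v) g ` lag_mat Y \<and>
      u - c *\<^sub>R v \<in> (*v) g ` lag_mat X)) \<longleftrightarrow> (\<exists>x. x \<noteq> 0 \<and> (Y - c *\<^sub>R X) *v x = 0)" for c
  proof -
    have "(\<exists>v\<in>(*v) g ` lag_mat 0. v \<noteq> 0 \<and> (\<exists>u\<in>(*v) g ` lag_inf. v - u \<in> (*v) g ` lag_mat Y \<and>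
      u - c *\<^sub>R v \<in> (*v) g ` lag_mat X)) \<longleftrightarrow>
      (\<exists>v\<in>lag_mat 0. v \<noteq> 0 \<and> (\<exists>u\<in>lag_inf. v - u \<in> lag_mat Y \<and> u - c *\<^sub>R v \<in> lag_mat X))"
      by (simp add: z mem2)
    \<comment> \<open>Here v = (0, x) and u = (t, 0). The two memberships give Yx = -t = c Xx, the
      generalised eigenvalue equation.\<close>
    also have "\<dots> \<longleftrightarrow> (\<exists>x. x \<noteq> 0 \<and> (\<exists>t. - t = Y *v x \<and> t = X *v (- (c *\<^sub>R x))))"
      by (auto simp: lag_mat_eq lag_inf_eq vec4_arith image_iff)
    also have "\<dots> \<longleftrightarrow> (\<exists>x. x \<noteq> 0 \<and> (Y - c *\<^sub>R X) *v x = 0)"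
    proof -
      have "X *v (- (c *\<^sub>R x)) = - (c *\<^sub>R (X *v x))" for x
        using matrix_vector_mult_scaleR[of X "- c" x] by simp
      moreover have "(Y - c *\<^sub>R X) *v x = Y *v x - c *\<^sub>R (X *v x)" for x
        by (simp add: matrix_vector_mult_diff_rdistrib scaleR_matrix_vector_assoc)
      ultimately have "(\<exists>t. - t = Y *v x \<and> t = X *v (- (c *\<^sub>R x))) \<longleftrightarrow> (Y - c *\<^sub>R X) *v x = 0" for x
        by auto
      then show ?thesis by simp
    qed
    finally show ?thesis .
  qed
  moreover have "det (Y - c *\<^sub>R X) = det X * c\<^sup>2 - (det (X + Y) - det X - det Y) * c + det Y" for c
    by (simp add: det_2 power2_eq_square algebra_simps)
  ultimately show ?thesis
    by (simp add: eigenvalues_on_cross_ratio[OF l] exists_kernel_iff_det)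
qed

lemma
  assumes "g \<in> carrier Sp4" "posdef X" "posdef (Y - X)"
  shows generic_lag_iff: "generic ((*v) g ` lag_mat 0) ((*v) g ` lag_mat X) ((*v) g ` lag_mat Y)
      ((*v) g ` lag_inf) \<longleftrightarrow> 0 < disc X Y"
    and nongeneric_lag_iff: "nongeneric ((*v) g ` lag_mat 0) ((*v) g ` lag_mat X) ((*v) g ` lag_mat Y)
      ((*v) g ` lag_inf) \<longleftrightarrow> disc X Y = 0"
proof -
  obtain p q r where "X = mat2 p q r" using assms(2) by (metis mat2_cases posdef_def)
  then have "0 < det X" using assms(2) by (simp add: posdef_mat2 det_mat2)
  then show "generic ((*v) g ` lag_mat 0) ((*v) g ` lag_mat X) ((*v) g ` lag_mat Y)
      ((*v) g ` lag_inf) \<longleftrightarrow> 0 < disc X Y"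
    "nongeneric ((*v) g ` lag_mat 0) ((*v) g ` lag_mat X) ((*v) g ` lag_mat Y)
      ((*v) g ` lag_inf) \<longleftrightarrow> disc X Y = 0"
    by (simp_all add: generic_def nongeneric_def maximal_lag_quadruple[OF assms]
        eigenvalues_on_lag_quadruple[OF assms] card_quadratic_roots disc_def del: One_nat_def)
qed

section \<open>Normal forms of hexagons\<close>

lemma posdef_congruence:
  assumes O: "orthogonal_matrix (O' :: real^'n^'n)" and S: "posdef S"
  shows "posdef (O' ** S ** transpose O')"
proof -
  have "x \<bullet> ((O' ** S ** transpose O') *v x) = (transpose O' *v x) \<bullet> (S *v (transpose O' *v x))" for x
    by (metis dot_lmul_matrix matrix_vector_mul_assoc transpose_matrix_vector)
  moreover have "transpose O' *v x \<noteq> 0" if "x \<noteq> 0" for x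
    using O that unfolding orthogonal_matrix_def
    by (metis matrix_vector_mul_assoc matrix_vector_mul_lid matrix_vector_mult_0_right)
  ultimately show ?thesis
    using S by (simp add: posdef_def matrix_transpose_mul matrix_mul_assoc)
qed

lemma det_congruence:
  fixes S :: "real^'n^'n"
  assumes "orthogonal_matrix O'" shows "det (O' ** S ** transpose O') = det S"
proof -
  have "det O' * det (transpose O') = 1"
    using assms by (metis det_I det_mul orthogonal_matrix_def)
  then show ?thesis by (simp add: det_mul)
qed

lemma congruence_arith:
  fixes A B :: "real^'n^'n"
  shows "O' ** (A + B) ** transpose O' = O' ** A ** transpose O' + O' ** B ** transpose O'"
    "O' ** (A - B) ** transpose O' = O' ** A ** transpose O' - O' ** B ** transpose O'"
    "O' ** (c *\<^sub>R A) ** transpose O' = c *\<^sub>R (O' ** A ** transpose O')"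
  by (simp_all add: matrix_matrix_mult_def vec_eq_iff
      sum_distrib_left sum_distrib_right algebra_simps sum_subtractf sum.distrib)

lemma disc_congruence:
  assumes "orthogonal_matrix O'"
  shows "disc (O' ** A ** transpose O') (O' ** B ** transpose O') = disc A B"
  by (simp add: disc_def det_congruence[OF assms] flip: congruence_arith)

text \<open>The traceless part of the matrix is half of \<open>\<rho>\<close> times the reflection
  with angle t; rotating by t/2 turns it into a diagonal matrix with the larger eigenvalue first,
  since a - b = \<open>\<rho>\<close>.\<close>

lemma symmetric_diagonalise:
  assumes d: "0 < disc (mat 1) (mat2 p q r)"
  obtains O' a b where "orthogonal_matrix O'" "b < a" "O' ** mat2 p q r ** transpose O' = mat2 a 0 b"
proof -
  define \<rho> where "\<rho> = sqrt ((p - r)\<^sup>2 + (2 * q)\<^sup>2)"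
  have "disc (mat 1) (mat2 p q r) = (p - r)\<^sup>2 + (2 * q)\<^sup>2"
    by (simp add: mat_1_mat2 disc_mat2) (simp add: power2_eq_square algebra_simps)
  with d have \<rho>2: "\<rho>\<^sup>2 = (p - r)\<^sup>2 + (2 * q)\<^sup>2" and \<rho>: "0 < \<rho>" by (simp_all add: \<rho>_def)
  have "((p - r) / \<rho>)\<^sup>2 + (2 * q / \<rho>)\<^sup>2 = 1"
  proof -
    have "((p - r) / \<rho>)\<^sup>2 + (2 * q / \<rho>)\<^sup>2 = \<rho>\<^sup>2 / \<rho>\<^sup>2"
      unfolding power_divide by (subst (3) \<rho>2) (simp add: add_divide_distrib)
    then show ?thesis using \<rho> by simp
  qed
  then obtain t where t: "(p - r) / \<rho> = cos t" "2 * q / \<rho> = sin t"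
    using sincos_total_2pi by metis
  define c s where "c = cos (t / 2)" and "s = sin (t / 2)"
  have cs: "c\<^sup>2 + s\<^sup>2 = 1" by (simp add: c_def s_def)
  have C: "(c\<^sup>2 - s\<^sup>2) * \<rho> = p - r" "2 * c * s * \<rho> = 2 * q"
  proof -
    have "c\<^sup>2 - s\<^sup>2 = (p - r) / \<rho>" "2 * c * s = 2 * q / \<rho>"
      unfolding t using cos_double[of "t / 2"] sin_double[of "t / 2"]
      by (simp_all add: c_def s_def)
    then show "(c\<^sup>2 - s\<^sup>2) * \<rho> = p - r" "2 * c * s * \<rho> = 2 * q" using \<rho> by simp_all
  qed
  define O' :: "real^2^2" where "O' = vector [vector [c, s], vector [- s, c]]"
  have O': "orthogonal_matrix O'"
    using cs by (simp add: orthogonal_matrix O'_def matrix_matrix_mult_def transpose_def sum_2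
        vec_eq_iff forall_2 mat_def power2_eq_square algebra_simps)
  define a b where "a = c\<^sup>2 * p + 2 * c * s * q + s\<^sup>2 * r" and "b = s\<^sup>2 * p - 2 * c * s * q + c\<^sup>2 * r"
  have off: "c * s * (r - p) + (c\<^sup>2 - s\<^sup>2) * q = 0"
  proof -
    have "\<rho> * (c * s * (r - p) + (c\<^sup>2 - s\<^sup>2) * q) =
        (2 * c * s * \<rho>) / 2 * (r - p) + ((c\<^sup>2 - s\<^sup>2) * \<rho>) * q"
      by (simp add: algebra_simps)
    also have "\<dots> = 0" unfolding C by (simp add: algebra_simps)
    finally show ?thesis using \<rho> by simp
  qed
  have "\<rho> * (a - b) = ((c\<^sup>2 - s\<^sup>2) * \<rho>) * (p - r) + (2 * c * s * \<rho>) * (2 * q)"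
    by (simp add: a_def b_def algebra_simps)
  also have "\<dots> = \<rho>\<^sup>2" unfolding C \<rho>2 by (simp add: power2_eq_square)
  finally have "a - b = \<rho>" using \<rho> by (simp add: power2_eq_square)
  with \<rho> have "b < a" by simp
  have "O' ** mat2 p q r ** transpose O' = mat2 a 0 b"
    using off
    by (simp add: O'_def matrix_matrix_mult_def transpose_def sum_2 vec_eq_iff forall_2 a_def b_def
        power2_eq_square algebra_simps)
  then show ?thesis using that O' \<open>b < a\<close> by blast
qed

text \<open>The image of \<open>aa\<close> under the exponential in each coordinate.\<close>

definition spectra :: "(real \<times> real) set" where
  "spectra = {(x, y). y < x \<and> 1 < y}"

definition core_mid :: "real \<times> real \<Rightarrow> real^2^2" where
  "core_mid = (\<lambda>(m, n). mat2 m 0 n)"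

text \<open>With \<open>M\<close> the middle matrix and \<open>c = cos \<alpha>\<close>, this is \<open>\<surd>M R diag(v, w) R\<inverse> \<surd>M\<close> for the
  rotation \<open>R\<close> by the angle \<open>\<alpha>/2\<close>.\<close>

definition core_top :: "real \<times> real \<Rightarrow> real \<times> real \<Rightarrow> real \<Rightarrow> real^2^2" where
  "core_top = (\<lambda>(m, n) (v, w) c.
     mat2 (m * ((v + w) / 2 + (v - w) / 2 * c)) (sqrt (m * n) * ((v - w) / 2) * sqrt (1 - c\<^sup>2))
       (n * ((v + w) / 2 - (v - w) / 2 * c)))"

definition core :: "real^2^2 \<Rightarrow> real^2^2 \<Rightarrow> bool" where
  "core M N \<longleftrightarrow> posdef (M - mat 1) \<and> posdef (N - M) \<and> 0 < disc (mat 1) M \<and> 0 < disc M N"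

text \<open>After M is diagonalised, a diagonal sign matrix still acts and makes the off-diagonal
  entry of N nonnegative. The three entries of N are then equivalent to the two eigenvalues of the
  inverse of M times N together with one number c.\<close>

lemma core_normal_form:
  assumes "core M N"
  obtains O' \<mu> \<nu> c where "orthogonal_matrix O'" "\<mu> \<in> spectra" "\<nu> \<in> spectra" "c \<in> {-1..1}"
    "O' ** M ** transpose O' = core_mid \<mu>" "O' ** N ** transpose O' = core_top \<mu> \<nu> c"
proof -
  have sym: "transpose (M - mat 1) = M - mat 1" "transpose (N - M) = N - M"
    using assms by (auto simp: core_def posdef_def)
  then have "transpose M = M"
    by (simp add: transpose_def vec_eq_iff mat_def) (smt (verit))
  moreover with sym have "transpose N = N"
    by (simp add: transpose_def vec_eq_iff)
  ultimately obtain p q r where M: "M = mat2 p q r" and N_sym: "transpose N = N"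
    using mat2_cases by metis
  obtain O1 m n where O1: "orthogonal_matrix O1" "n < m" "O1 ** M ** transpose O1 = mat2 m 0 n"
    using symmetric_diagonalise[of p q r] assms unfolding M core_def by blast
  \<comment> \<open>Conjugation by diag(1, sg) multiplies the off-diagonal entry by sg and leaves
    diagonal matrices alone.\<close>
  define sg where "sg = (if 0 \<le> (O1 ** N ** transpose O1) $ 1 $ 2 then 1 else -1 :: real)"
  have sg: "sg * sg = 1" by (simp add: sg_def)
  define O' where "O' = mat2 1 0 sg ** O1"
  have O2: "orthogonal_matrix (mat2 1 0 sg)"
    using sg by (simp add: orthogonal_matrix matrix_matrix_mult_def sum_2 vec_eq_iff forall_2 mat_def)
  then have O': "orthogonal_matrix O'"
    unfolding O'_def by (intro orthogonal_matrix_mul O1)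
  have conj: "O' ** S ** transpose O' = mat2 1 0 sg ** (O1 ** S ** transpose O1) ** mat2 1 0 sg" for S
    by (simp add: O'_def matrix_transpose_mul matrix_mul_assoc)
  have M': "O' ** M ** transpose O' = mat2 m 0 n"
    unfolding conj O1(3) using sg
    by (simp add: matrix_matrix_mult_def sum_2 vec_eq_iff forall_2)
  have "transpose (O1 ** N ** transpose O1) = O1 ** N ** transpose O1"
    by (simp add: matrix_transpose_mul N_sym matrix_mul_assoc)
  then obtain a b0 d where N1: "O1 ** N ** transpose O1 = mat2 a b0 d"
    using mat2_cases by metis
  define b where "b = sg * b0"
  have N': "O' ** N ** transpose O' = mat2 a b d"
    unfolding conj N1 using sg
    by (simp add: matrix_matrix_mult_def sum_2 vec_eq_iff forall_2 b_def)
  have b: "0 \<le> b" by (auto simp: b_def sg_def N1)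
  have I': "O' ** mat 1 ** transpose O' = mat 1"
    using O' by (simp add: orthogonal_matrix_def)
  have "posdef (O' ** (M - mat 1) ** transpose O')" "posdef (O' ** (N - M) ** transpose O')"
    using assms O' by (simp_all add: core_def posdef_congruence)
  then have pd: "posdef (mat2 m 0 n - mat 1)" "posdef (mat2 a b d - mat2 m 0 n)"
    unfolding congruence_arith M' N' I' .
  then have mn: "1 < m" "1 < n" and ad: "m < a" "0 < (a - m) * (d - n) - b\<^sup>2"
    by (auto simp: mat_1_mat2 mat2_arith posdef_mat2 zero_less_mult_iff)
  then have "0 < (a - m) * (d - n)" by (smt (verit) zero_le_power2)
  with ad have dn: "n < d" by (simp add: zero_less_mult_iff)
  have D: "0 < (m * d + n * a)\<^sup>2 - 4 * (m * n) * (a * d - b\<^sup>2)"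
    using assms disc_congruence[OF O', of M N] by (simp add: core_def M' N' disc_mat2)
  \<comment> \<open>Trace and determinant of the inverse of M times N; below, v and w are the roots
    of the characteristic polynomial and e is half their difference.\<close>
  define t \<delta> where "t = a / m + d / n" and "\<delta> = (a * d - b\<^sup>2) / (m * n)"
  have "t\<^sup>2 - 4 * \<delta> = ((m * d + n * a)\<^sup>2 - 4 * (m * n) * (a * d - b\<^sup>2)) / (m * n)\<^sup>2"
    using mn by (simp add: t_def \<delta>_def field_simps power2_eq_square)
  with D mn have D': "0 < t\<^sup>2 - 4 * \<delta>" by simp
  define e where "e = sqrt (t\<^sup>2 - 4 * \<delta>) / 2"
  have e: "0 < e" "4 * e\<^sup>2 = t\<^sup>2 - 4 * \<delta>" using D' by (simp_all add: e_def power_divide)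
  define v w where "v = t / 2 + e" and "w = t / 2 - e"
  have vw: "(v + w) / 2 = t / 2" "(v - w) / 2 = e" "v * w = \<delta>"
  proof -
    have "4 * (v * w) = t\<^sup>2 - 4 * e\<^sup>2"
      by (simp add: v_def w_def power2_eq_square algebra_simps)
    then show "v * w = \<delta>" using e(2) by simp
  qed (simp_all add: v_def w_def)
  \<comment> \<open>The determinant of N - M divided by that of M. Being positive, it puts v and w
    on the same side of 1, and the trace bound t > 2 selects the side.\<close>
  have "(v - 1) * (w - 1) = ((a - m) * (d - n) - b\<^sup>2) / (m * n)"
  proof -
    have "(v - 1) * (w - 1) = \<delta> - t + 1"
      unfolding vw(3)[symmetric] by (simp add: v_def w_def algebra_simps)
    also have "\<dots> = ((a - m) * (d - n) - b\<^sup>2) / (m * n)"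
      using mn by (simp add: \<delta>_def t_def field_simps)
    finally show ?thesis .
  qed
  then have "0 < (v - 1) * (w - 1)" using ad mn by simp
  moreover have "2 < t"
  proof -
    have "1 < a / m" "1 < d / n" using ad dn mn by simp_all
    then show ?thesis by (simp add: t_def)
  qed
  then have "1 < v" using e by (simp add: v_def)
  ultimately have w: "1 < w" by (simp add: zero_less_mult_iff)
  have wv: "w < v" using e by (simp add: v_def w_def)
  \<comment> \<open>Solved from the first diagonal entry of N. The trace then yields the second one
    and the determinant yields b squared, whose nonnegativity is exactly the bound on c.\<close>
  define c where "c = (a / m - t / 2) / e"
  have a: "a = m * (t / 2 + e * c)" using mn e by (simp add: c_def)
  have d: "d = n * (t / 2 - e * c)" using mn e by (simp add: c_def t_def field_simps)
  have "b\<^sup>2 = a * d - m * n * \<delta>" using mn by (simp add: \<delta>_def)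
  also have "\<dots> = m * n * (t\<^sup>2 / 4 - e\<^sup>2 * c\<^sup>2 - \<delta>)"
    by (simp add: a d power2_eq_square field_simps)
  also have "\<dots> = m * n * (e\<^sup>2 * (1 - c\<^sup>2))"
  proof -
    have "t\<^sup>2 / 4 - e\<^sup>2 * c\<^sup>2 - \<delta> = e\<^sup>2 * (1 - c\<^sup>2)"
      using e(2) by (simp add: right_diff_distrib)
    then show ?thesis by simp
  qed
  finally have b2: "b\<^sup>2 = m * n * (e\<^sup>2 * (1 - c\<^sup>2))" .
  then have "0 \<le> m * n * (e\<^sup>2 * (1 - c\<^sup>2))" by (metis zero_le_power2)
  moreover have "0 < m * n * e\<^sup>2" using mn e by simp
  ultimately have "0 \<le> 1 - c\<^sup>2" by (metis mult.assoc mult_pos_neg not_le)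
  then have c2: "c\<^sup>2 \<le> 1" by simp
  have "b = sqrt (m * n * (e\<^sup>2 * (1 - c\<^sup>2)))" using b b2 by (metis real_sqrt_unique)
  also have "\<dots> = sqrt (m * n) * e * sqrt (1 - c\<^sup>2)" using e by (simp add: real_sqrt_mult)
  finally have "mat2 a b d = core_top (m, n) (v, w) c"
    unfolding core_top_def prod.case vw(1,2) a d by simp
  moreover have "c \<in> {-1..1}" using c2 by (auto simp: abs_square_le_1 abs_le_iff)
  ultimately show ?thesis
    using that[OF O', of "(m, n)" "(v, w)" c] mn w wv O1(2) M' N'
    by (simp add: spectra_def core_mid_def)
qed

text \<open>Both discriminants are squares of nonzero numbers, and the determinant of the difference
  N - M is m n (v - 1) (w - 1), in which c has cancelled.\<close>

lemma core_core_normal_form: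
  assumes "\<mu> \<in> spectra" "\<nu> \<in> spectra" "c \<in> {-1..1}"
  shows "core (core_mid \<mu>) (core_top \<mu> \<nu> c)"
proof -
  obtain m n v w where mn: "\<mu> = (m, n)" "n < m" "1 < n" and vw: "\<nu> = (v, w)" "w < v" "1 < w"
    using assms by (auto simp: spectra_def)
  define e where "e = (v - w) / 2"
  have e: "0 < e" "(v + w) / 2 = w + e" using vw by (simp_all add: e_def field_simps)
  have "c\<^sup>2 \<le> 1" using assms by (simp add: abs_square_le_1 abs_le_iff)
  then have s: "(sqrt (1 - c\<^sup>2))\<^sup>2 = 1 - c\<^sup>2" "(sqrt (m * n))\<^sup>2 = m * n" using mn by simp_all
  have top: "core_top \<mu> \<nu> c = mat2 (m * (w + e + e * c)) (sqrt (m * n) * e * sqrt (1 - c\<^sup>2))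
      (n * (w + e - e * c))"
    unfolding core_top_def mn(1) vw(1) prod.case e(2) e_def[symmetric] by simp
  have "disc (mat 1) (core_mid \<mu>) = (m - n)\<^sup>2"
    by (simp add: core_mid_def mn mat_1_mat2 disc_mat2) (simp add: power2_eq_square algebra_simps)
  moreover have "disc (core_mid \<mu>) (core_top \<mu> \<nu> c) = (m * n * (2 * e))\<^sup>2"
    by (simp add: core_mid_def mn(1) top[unfolded mn(1)] disc_mat2 power_mult_distrib s)
       (simp add: power2_eq_square algebra_simps)
  moreover have "posdef (core_mid \<mu> - mat 1)"
    using mn by (simp add: core_mid_def mat_1_mat2 mat2_arith posdef_mat2)
  moreover have "posdef (core_top \<mu> \<nu> c - core_mid \<mu>)"
  proof -
    have "e * (1 + c) \<ge> 0" using assms e by simp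
    then have "1 < w + e + e * c" using vw by (simp add: algebra_simps)
    then have "m * (w + e + e * c) - m > 0" using mn by simp
    moreover have "(m * (w + e + e * c) - m) * (n * (w + e - e * c) - n) -
        (sqrt (m * n) * e * sqrt (1 - c\<^sup>2))\<^sup>2 = m * n * ((w - 1) * (w - 1 + 2 * e))"
      by (simp add: power_mult_distrib s) (simp add: power2_eq_square algebra_simps)
    moreover have "m * n * ((w - 1) * (w - 1 + 2 * e)) > 0" using mn vw e by simp
    ultimately show ?thesis by (simp add: core_mid_def mn(1) top[unfolded mn(1)] mat2_arith posdef_mat2)
  qed
  ultimately show ?thesis using mn vw e by (simp add: core_def)
qed

section \<open>Hexagons modulo the symplectic group\<close>

text \<open>The block matrix diag(O', O') is symplectic because the lower block is the inverse
  transpose of the upper one. It acts on graphs by congruence, and so fixes the graphs of 0 and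
  1.\<close>

lemma orthogonal_block:
  assumes O: "orthogonal_matrix O'"
  obtains g where "g \<in> carrier Sp4" "(*v) g ` lag_inf = lag_inf"
    "\<And>S. (*v) g ` lag_mat S = lag_mat (O' ** S ** transpose O')"
proof -
  define g :: "real^4^4" where "g = transpose (vector [vec4 (column 1 O') 0, vec4 (column 2 O') 0,
      vec4 0 (column 1 O'), vec4 0 (column 2 O')])"
  have g: "g *v vec4 x y = vec4 (O' *v x) (O' *v y)" for x y
    by (simp add: g_def vec_eq_iff forall_4 matrix_vector_mult_def transpose_def sum_4 sum_2
        column_def algebra_simps)
  have OO: "transpose O' *v (O' *v x) = x" "O' *v (transpose O' *v x) = x" for x
    using O by (simp_all add: orthogonal_matrix_def matrix_vector_mul_assoc
        del: transpose_matrix_vector)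
  then have "(O' *v x) \<bullet> (O' *v y) = x \<bullet> y" for x y
    by (metis dot_lmul_matrix transpose_matrix_vector)
  then have "sform (g *v vec4 x y) (g *v vec4 x' y') = sform (vec4 x y) (vec4 x' y')" for x y x' y'
    by (simp add: g)
  then have "g \<in> carrier Sp4" unfolding carrier_Sp4_iff by (metis vec4_cases)
  moreover have "(*v) g ` lag_inf = lag_inf"
    unfolding lag_inf_eq image_image g using OO by (auto simp: image_iff) metis
  moreover have "(*v) g ` lag_mat S = lag_mat (O' ** S ** transpose O')" for S
  proof -
    have "range (\<lambda>x. vec4 (O' *v (S *v x)) (O' *v x)) =
        range (\<lambda>y. vec4 ((O' ** S ** transpose O') *v y) y)"
    proof (intro subset_antisym subsetI; elim rangeE)
      fix v x assume "v = vec4 (O' *v (S *v x)) (O' *v x)"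
      then have "v = vec4 ((O' ** S ** transpose O') *v (O' *v x)) (O' *v x)"
        by (simp add: OO del: transpose_matrix_vector flip: matrix_vector_mul_assoc)
      then show "v \<in> range (\<lambda>y. vec4 ((O' ** S ** transpose O') *v y) y)" by blast
    next
      fix v y assume "v = vec4 ((O' ** S ** transpose O') *v y) y"
      then have "v = vec4 (O' *v (S *v (transpose O' *v y))) (O' *v (transpose O' *v y))"
        by (simp add: OO del: transpose_matrix_vector flip: matrix_vector_mul_assoc)
      then show "v \<in> range (\<lambda>x. vec4 (O' *v (S *v x)) (O' *v x))" by blast
    qed
    then show ?thesis by (simp add: lag_mat_eq image_image g)
  qed
  ultimately show ?thesis using that by blast
qed

definition hexagon_image :: "real^4^4 \<Rightarrow> hexagon \<Rightarrow> hexagon" where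
  "hexagon_image g = (\<lambda>(P, A, B, C, D, Q). ((*v) g ` P, (*v) g ` A, (*v) g ` B, (*v) g ` C,
     (*v) g ` D, (*v) g ` Q))"

definition hexagon_of :: "real^2^2 \<Rightarrow> real^2^2 \<Rightarrow> real^2^2 \<Rightarrow> hexagon" where
  "hexagon_of B C D = (lag_mat 0, lag_mat (mat 1), lag_mat B, lag_mat C, lag_mat D, lag_inf)"

lemma hexagon_image_mult: "hexagon_image (g ** h) H = hexagon_image g (hexagon_image h H)"
  by (simp add: hexagon_image_def Sp4_image_mult split: prod.splits)

lemma hexagon_image_mat_1 [simp]: "hexagon_image (mat 1) H = H"
  by (simp add: hexagon_image_def split: prod.splits)

lemma posdef_mat_1: "posdef (mat 1 :: real^2^2)"
  by (simp add: mat_1_mat2 posdef_mat2)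

lemma maximal_hexagon_of:
  assumes pd: "posdef (B - mat 1)" "posdef (C - B)" "posdef (D - C)"
  shows "maximal [lag_mat 0, lag_mat (mat 1), lag_mat B, lag_mat C, lag_mat D, lag_inf]"
proof -
  have B: "posdef B" using posdef_add[OF posdef_mat_1 pd(1)] by simp
  have C: "posdef C" "posdef (C - mat 1)"
    using posdef_add[OF B pd(2)] posdef_add[OF pd(1,2)] by simp_all
  have D: "posdef D" "posdef (D - mat 1)" "posdef (D - B)"
    using posdef_add[OF C(1) pd(3)] posdef_add[OF C(2) pd(3)] posdef_add[OF pd(2,3)] by simp_all
  have "maximal (map lag_mat [0, mat 1, B, C, D] @ [lag_inf])"
    using pd B C D posdef_mat_1 by (intro maximal_lag_mat) (auto simp: posdef_def)
  then show ?thesis by simp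
qed

lemma maximal_hexagon_normal_form:
  assumes max: "maximal [P, A, B, C, D, Q]"
  obtains g B' C' D' where "g \<in> carrier Sp4" "(P, A, B, C, D, Q) = hexagon_image g (hexagon_of B' C' D')"
    "posdef (B' - mat 1)" "posdef (C' - B')" "posdef (D' - C')"
proof -
  have triples: "maximal_triple P A Q" "maximal_triple A B Q" "maximal_triple B C Q" "maximal_triple C D Q"
    using maximal_nth[OF max, of 0 1 5] maximal_nth[OF max, of 1 2 5] maximal_nth[OF max, of 2 3 5]
      maximal_nth[OF max, of 3 4 5] by simp_all
  obtain k where k: "k \<in> carrier Sp4" "P = (*v) k ` lag_inf" "A = (*v) k ` lag_mat 0"
      "Q = (*v) k ` lag_mat (mat 1)"
    using triples(1) by (auto simp: maximal_triple_def)
  \<comment> \<open>The model triple of \<open>maximal_triple\<close> is (\<infinity>, 0, 1),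
    whereas (P, A, Q) is to become (0, 1, \<infinity>). On graphs, h is the map sending Z to 1 minus
    the inverse of Z, which takes 0, 1, \<infinity> to \<infinity>, 0, 1.\<close>
  define h :: "real^4^4" where "h = vector [axis 1 1 - axis 3 1, axis 2 1 - axis 4 1, axis 1 1, axis 2 1]"
  have h: "h *v vec4 x y = vec4 (x - y) x" for x y
    by (simp add: h_def vec_eq_iff forall_4 matrix_vector_mult_def sum_4 axis_def)
  have "sform (h *v vec4 x y) (h *v vec4 x' y') = sform (vec4 x y) (vec4 x' y')" for x y x' y'
    by (simp add: h inner_simps inner_commute)
  then have hS: "h \<in> carrier Sp4" unfolding carrier_Sp4_iff by (metis vec4_cases)
  define g where "g = k ** h"
  have g: "g \<in> carrier Sp4" unfolding g_def by (rule Sp4_mult[OF k(1) hS])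
  have "range (\<lambda>x. vec4 (- x) (0 :: real^2)) = range (\<lambda>x. vec4 x 0)"
    by (auto simp: image_iff) (metis minus_minus)
  then have h0: "(*v) h ` lag_mat 0 = lag_inf" by (simp add: lag_mat_eq lag_inf_eq image_image h)
  have h1: "(*v) h ` lag_mat (mat 1) = lag_mat 0" by (simp add: lag_mat_eq image_image h)
  have h2: "(*v) h ` lag_inf = lag_mat (mat 1)" by (simp add: lag_mat_eq lag_inf_eq image_image h)
  have PAQ: "P = (*v) g ` lag_mat 0" "A = (*v) g ` lag_mat (mat 1)" "Q = (*v) g ` lag_inf"
    by (simp_all add: g_def Sp4_image_mult h0 h1 h2 k)
  obtain i where i: "i \<in> carrier Sp4" "i ** g = mat 1" "g ** i = mat 1" by (rule Sp4_inverse[OF g])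
  have ig: "(*v) i ` (*v) g ` l = l" and gi: "(*v) g ` (*v) i ` l = l" for l
    by (simp_all add: i flip: Sp4_image_mult)
  \<comment> \<open>Every triple ending in Q makes its middle member transverse to Q, hence a graph
    once Q is moved to \<open>lag_inf\<close>.\<close>
  have graph: "\<exists>S. transpose S = S \<and> Y = (*v) g ` lag_mat S" if "maximal_triple X Y Q" for X Y
  proof -
    have "maximal_triple ((*v) i ` X) ((*v) i ` Y) lag_inf"
      using maximal_triple_image[OF i(1) that] by (simp add: PAQ ig)
    then obtain S where "transpose S = S" "(*v) i ` Y = lag_mat S"
      using lagrangian_graph by (metis maximal_triple_def)
    then show ?thesis by (metis gi)
  qed
  have order: "posdef (T - S)" if "transpose S = S" "transpose T = T"
      "maximal_triple ((*v) g ` lag_mat S) ((*v) g ` lag_mat T) Q" for S T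
    using maximal_triple_image[OF i(1) that(3)] that(1,2)
    by (simp add: PAQ ig maximal_triple_lag_inf)
  obtain B' C' D' where S: "transpose B' = B'" "B = (*v) g ` lag_mat B'" "transpose C' = C'"
      "C = (*v) g ` lag_mat C'" "transpose D' = D'" "D = (*v) g ` lag_mat D'"
    using graph[OF triples(2)] graph[OF triples(3)] graph[OF triples(4)] by blast
  have "posdef (B' - mat 1)" "posdef (C' - B')" "posdef (D' - C')"
    using triples(2-4) S by (auto intro!: order simp: PAQ(2))
  then show ?thesis
    using that[OF g, of B' C' D'] by (simp add: hexagon_image_def hexagon_of_def PAQ S)
qed

text \<open>A single indexed family, so that the argument runs once for all three types; every
  \<open>j\<close> other than 1 and 2 stands for the third type.\<close>

definition nongeneric_hexagons :: "nat \<Rightarrow> hexagon set" where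
  "nongeneric_hexagons j =
     (if j = 1 then H_nongen_type1_1 else if j = 2 then H_nongen_type1_2 else H_nongen_type1_3)"

text \<open>The non-generic step multiplies by a scalar \<open>l\<close>; deleting it leaves a generic triple
  \<open>(1, M, N)\<close>, the same for all three types.\<close>

definition core_hexagon :: "nat \<Rightarrow> real \<Rightarrow> real^2^2 \<Rightarrow> real^2^2 \<Rightarrow> hexagon" where
  "core_hexagon j l M N =
     (if j = 1 then hexagon_of (l *\<^sub>R mat 1) (l *\<^sub>R M) (l *\<^sub>R N)
      else if j = 2 then hexagon_of M (l *\<^sub>R M) (l *\<^sub>R N)
      else hexagon_of M N (l *\<^sub>R N))"

definition normal_hexagon :: "nat \<Rightarrow> real \<times> (real \<times> real) \<times> (real \<times> real) \<times> real \<Rightarrow> hexagon" where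
  "normal_hexagon j = (\<lambda>(l, \<mu>, \<nu>, c). core_hexagon j l (core_mid \<mu>) (core_top \<mu> \<nu> c))"

definition params :: "(real \<times> (real \<times> real) \<times> (real \<times> real) \<times> real) set" where
  "params = {1<..} \<times> spectra \<times> spectra \<times> {-1..1}"

lemma core_scale:
  assumes "0 < l" "posdef (M - mat 1)" "posdef (N - M)"
  shows "posdef (l *\<^sub>R M - l *\<^sub>R mat 1)" "posdef (l *\<^sub>R N - l *\<^sub>R M)"
  using assms by (simp_all add: posdef_scale flip: scaleR_diff_right)

lemma posdef_scale_diff: "posdef M \<Longrightarrow> 1 < l \<Longrightarrow> posdef (l *\<^sub>R M - M)"
  using posdef_scale[of "l - 1" M] by (simp add: scaleR_left_diff_distrib)

lemma core_hexagon_mem: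
  assumes c: "core M N" and l: "1 < l" and g: "g \<in> carrier Sp4"
  shows "hexagon_image g (core_hexagon j l M N) \<in> nongeneric_hexagons j"
proof -
  have pd: "posdef (M - mat 1)" "posdef (N - M)" and d: "0 < disc (mat 1) M" "0 < disc M N"
    using c by (simp_all add: core_def)
  have M: "posdef M" using posdef_add[OF posdef_mat_1 pd(1)] by simp
  have N: "posdef N" using posdef_add[OF M pd(2)] by simp
  have lpd: "posdef (l *\<^sub>R M - l *\<^sub>R mat 1)" "posdef (l *\<^sub>R N - l *\<^sub>R M)" "posdef (l *\<^sub>R mat 1 - (mat 1 :: real^2^2))"
      "posdef (l *\<^sub>R M - M)" "posdef (l *\<^sub>R N - N)" "posdef (l *\<^sub>R (mat 1 :: real^2^2))"
      "posdef (l *\<^sub>R M)" "posdef (l *\<^sub>R N)"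
    using core_scale[OF _ pd, of l] M N posdef_mat_1 l
    by (simp_all add: posdef_scale_diff posdef_scale)
  have disc_self: "disc X X = 0" for X
    by (simp add: disc_def det_2 power2_eq_square algebra_simps)
  have ds: "disc (l *\<^sub>R X) (l *\<^sub>R Y) = (l * l)\<^sup>2 * disc X Y" "disc X (l *\<^sub>R X) = 0" for X Y
    using disc_scale[of l X l Y] disc_scale[of 1 X l X] by (simp_all add: disc_self)
  have max: "maximal [(*v) g ` lag_mat 0, (*v) g ` lag_mat (mat 1), (*v) g ` lag_mat B, (*v) g ` lag_mat C,
      (*v) g ` lag_mat D, (*v) g ` lag_inf]"
    if "posdef (B - mat 1)" "posdef (C - B)" "posdef (D - C)" for B C D
    using maximal_image[OF g maximal_hexagon_of[OF that]] by simp
  show ?thesis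
    using pd lpd M N posdef_mat_1 d l
    by (simp add: nongeneric_hexagons_def core_hexagon_def hexagon_of_def hexagon_image_def max ds
        H_nongen_type1_1_def H_nongen_type1_2_def H_nongen_type1_3_def generic_lag_iff[OF g]
        nongeneric_lag_iff[OF g])
qed

text \<open>The vanishing discriminant yields the scalar l. Common scaling by l > 0 affects neither
  the Loewner order nor the sign of \<open>disc\<close>, so the conditions on the remaining matrices
  pass to the core.\<close>

lemma nongeneric_hexagons_core:
  assumes "H \<in> nongeneric_hexagons j"
  obtains g l M N where "g \<in> carrier Sp4" "1 < l" "core M N" "H = hexagon_image g (core_hexagon j l M N)"
proof -
  obtain P A B0 C0 D0 Q where H: "H = (P, A, B0, C0, D0, Q)" by (metis prod_cases6)
  have "maximal [P, A, B0, C0, D0, Q]"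
    using assms by (auto simp: H nongeneric_hexagons_def H_nongen_type1_1_def H_nongen_type1_2_def
        H_nongen_type1_3_def split: if_splits)
  then obtain g B C D where g: "g \<in> carrier Sp4" and H': "H = hexagon_image g (hexagon_of B C D)"
    and pd: "posdef (B - mat 1)" "posdef (C - B)" "posdef (D - C)"
    unfolding H by (rule maximal_hexagon_normal_form)
  have B: "posdef B" using posdef_add[OF posdef_mat_1 pd(1)] by simp
  have C: "posdef C" using posdef_add[OF B pd(2)] by simp
  have inv: "X = l *\<^sub>R ((1 / l) *\<^sub>R X)" if "1 < l" for l and X :: "real^2^2" using that by simp
  note iffs = generic_lag_iff[OF g posdef_mat_1 pd(1)] generic_lag_iff[OF g B pd(2)]
      generic_lag_iff[OF g C pd(3)] nongeneric_lag_iff[OF g posdef_mat_1 pd(1)]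
      nongeneric_lag_iff[OF g B pd(2)] nongeneric_lag_iff[OF g C pd(3)]
  consider "j = 1" | "j = 2" | "j \<noteq> 1" "j \<noteq> 2" by blast
  then show ?thesis
  proof cases
    case 1
    with assms have d: "disc (mat 1) B = 0" "0 < disc B C" "0 < disc C D"
      unfolding H' by (simp_all add: nongeneric_hexagons_def H_nongen_type1_1_def hexagon_image_def
          hexagon_of_def iffs)
    obtain l where l: "1 < l" "B = l *\<^sub>R mat 1"
      by (rule disc_zero_imp_proportional[OF posdef_mat_1 pd(1) d(1)])
    define M N where "M = (1 / l) *\<^sub>R C" and "N = (1 / l) *\<^sub>R D"
    have CD: "C = l *\<^sub>R M" "D = l *\<^sub>R N" using l by (simp_all add: M_def N_def)
    have "core M N"
      using l(1) pd(2,3) d(2,3) posdef_scale[of l "M - mat 1"] posdef_scale[of l "N - M"]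
      unfolding core_def CD l(2) disc_scale scaleR_diff_right[symmetric]
      by (simp add: zero_less_mult_iff)
    then show ?thesis
      using that[OF g l(1), of M N] 1 by (simp add: H' core_hexagon_def CD l)
  next
    case 2
    with assms have d: "0 < disc (mat 1) B" "disc B C = 0" "0 < disc C D"
      unfolding H' by (simp_all add: nongeneric_hexagons_def H_nongen_type1_2_def hexagon_image_def
          hexagon_of_def iffs)
    obtain l where l: "1 < l" "C = l *\<^sub>R B"
      by (rule disc_zero_imp_proportional[OF B pd(2) d(2)])
    define N where "N = (1 / l) *\<^sub>R D"
    have D: "D = l *\<^sub>R N" using l by (simp add: N_def)
    have "core B N"
      using l(1) pd(1,3) d(1,3) posdef_scale[of l "N - B"]
      unfolding core_def D l(2) disc_scale scaleR_diff_right[symmetric]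
      by (simp add: zero_less_mult_iff)
    then show ?thesis
      using that[OF g l(1), of B N] 2 by (simp add: H' core_hexagon_def D l)
  next
    case 3
    with assms have d: "0 < disc (mat 1) B" "0 < disc B C" "disc C D = 0"
      unfolding H' by (simp_all add: nongeneric_hexagons_def H_nongen_type1_3_def hexagon_image_def
          hexagon_of_def iffs)
    obtain l where l: "1 < l" "D = l *\<^sub>R C"
      by (rule disc_zero_imp_proportional[OF C pd(3) d(3)])
    have "core B C" using pd d by (simp add: core_def)
    then show ?thesis
      using that[OF g l(1), of B C] 3 by (simp add: H' core_hexagon_def l)
  qed
qed

text \<open>Congruence by \<open>O'\<close> is linear and fixes the identity, so it commutes with
  inserting the scalar l: the normal form of the core gives that of the hexagon, for each
  type.\<close>

proposition nongeneric_hexagons_iff: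
  "H \<in> nongeneric_hexagons j \<longleftrightarrow> (\<exists>g\<in>carrier Sp4. \<exists>k\<in>params. H = hexagon_image g (normal_hexagon j k))"
proof
  assume "H \<in> nongeneric_hexagons j"
  then obtain g l M N where g: "g \<in> carrier Sp4" and l: "1 < l" and c: "core M N"
    and H: "H = hexagon_image g (core_hexagon j l M N)"
    by (rule nongeneric_hexagons_core)
  obtain O' \<mu> \<nu> c where O': "orthogonal_matrix O'" and k: "\<mu> \<in> spectra" "\<nu> \<in> spectra" "c \<in> {-1..1}"
    and MN: "O' ** M ** transpose O' = core_mid \<mu>" "O' ** N ** transpose O' = core_top \<mu> \<nu> c"
    using core_normal_form[OF c] by metis
  obtain h where h: "h \<in> carrier Sp4" "(*v) h ` lag_inf = lag_inf"
    "\<And>S. (*v) h ` lag_mat S = lag_mat (O' ** S ** transpose O')"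
    by (rule orthogonal_block[OF O']) blast
  obtain i where i: "i \<in> carrier Sp4" "i ** h = mat 1" by (rule Sp4_inverse[OF h(1)])
  have O1: "O' ** mat 1 ** transpose O' = mat 1" "O' ** 0 ** transpose O' = 0"
    "O' ** transpose O' = mat 1"
    using O' by (simp_all add: orthogonal_matrix_def)
  have "hexagon_image h (core_hexagon j l M N) = normal_hexagon j (l, \<mu>, \<nu>, c)"
    by (simp add: core_hexagon_def normal_hexagon_def hexagon_of_def hexagon_image_def h
        congruence_arith MN O1)
  moreover have "hexagon_image i (hexagon_image h X) = X" for X
    by (simp add: i flip: hexagon_image_mult)
  ultimately have "H = hexagon_image (g ** i) (normal_hexagon j (l, \<mu>, \<nu>, c))"
    by (metis H hexagon_image_mult)
  then show "\<exists>g\<in>carrier Sp4. \<exists>k\<in>params. H = hexagon_image g (normal_hexagon j k)"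
    using Sp4_mult[OF g i(1)] k l unfolding params_def by (intro bexI) auto
next
  assume "\<exists>g\<in>carrier Sp4. \<exists>k\<in>params. H = hexagon_image g (normal_hexagon j k)"
  then show "H \<in> nongeneric_hexagons j"
    by (auto simp: normal_hexagon_def params_def intro!: core_hexagon_mem core_core_normal_form)
qed

section \<open>Invariants of frames\<close>

text \<open>The adjugate, by Cayley-Hamilton in dimension 2; polynomial in the entries.\<close>

definition adj2 :: "real^2^2 \<Rightarrow> real^2^2" where
  "adj2 M = trace M *\<^sub>R mat 1 - M"

text \<open>The zero matrix if \<open>M\<close> is singular.\<close>

definition inv2 :: "real^2^2 \<Rightarrow> real^2^2" where
  "inv2 M = (1 / det M) *\<^sub>R adj2 M"

lemma scaleR_matrix_mult:
  fixes A :: "real^'n^'m" and B :: "real^'k^'n"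
  shows "(c *\<^sub>R A) ** B = c *\<^sub>R (A ** B)" "A ** (c *\<^sub>R B) = c *\<^sub>R (A ** B)"
  by (simp_all add: matrix_matrix_mult_def vec_eq_iff sum_distrib_left algebra_simps)

text \<open>The adjugate reverses arbitrary products, and if one factor is singular both sides are
  zero. Thus frames with degenerate pairings are covered in \<open>ratio_change\<close>.\<close>

lemma inv2_mult: "inv2 (A ** B) = inv2 B ** inv2 A"
proof -
  have "adj2 (A ** B) = adj2 B ** adj2 A"
    by (simp add: adj2_def trace_def sum_2 vec_eq_iff forall_2 matrix_matrix_mult_def mat_def algebra_simps)
  then show ?thesis by (simp add: inv2_def scaleR_matrix_mult det_mul)
qed

lemma inv2_inverse:
  assumes "det M \<noteq> 0" shows "M ** inv2 M = mat 1" "inv2 M ** M = mat 1"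
proof -
  have "M ** adj2 M = det M *\<^sub>R mat 1"
    by (simp add: adj2_def trace_def sum_2 det_2 vec_eq_iff forall_2 matrix_matrix_mult_def mat_def
        algebra_simps)
  then show "M ** inv2 M = mat 1" using assms by (simp add: inv2_def scaleR_matrix_mult)
  then show "inv2 M ** M = mat 1" by (simp add: matrix_left_right_inverse)
qed

lemma inv2_mat_1 [simp]: "inv2 (mat 1) = mat 1"
  using inv2_inverse(1)[of "mat 1"] by simp

text \<open>The symplectic pairings of the columns; for frames of Lagrangians it is invertible
  exactly if the planes are transverse.\<close>

definition gram :: "real^2^4 \<Rightarrow> real^2^4 \<Rightarrow> real^2^2" where
  "gram F G = transpose F ** J4 ** G"

lemma gram_change:
  assumes "g \<in> carrier Sp4"
  shows "gram (g ** F ** k) (g ** G ** h) = transpose k ** gram F G ** h"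
proof -
  have "gram (g ** F ** k) (g ** G ** h) = transpose k ** (transpose F ** (transpose g ** J4 ** g) ** G) ** h"
    by (simp add: gram_def matrix_transpose_mul matrix_mul_assoc)
  then show ?thesis using assms by (simp add: Sp4_def gram_def)
qed

lemma gram_frame: "gram (frame S T) (frame S' T') = transpose S ** T' - transpose T ** S'"
  by (simp add: gram_def J4_def vec_eq_iff forall_2 matrix_matrix_mult_def sum_4 sum_2 transpose_def
      axis_def algebra_simps)

text \<open>For \<open>p\<close>, \<open>x\<close>, \<open>y\<close>, \<open>q\<close> spanning \<open>P\<close>, \<open>X\<close>, \<open>Y\<close>, \<open>Q\<close> this is a matrix of the cross-ratio
  \<open>R(P,X,Y,Q)\<close>. All the matrices with the same \<open>p\<close> and \<open>q\<close> refer to the same basis.\<close>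

definition ratio :: "real^2^4 \<Rightarrow> real^2^4 \<Rightarrow> real^2^4 \<Rightarrow> real^2^4 \<Rightarrow> real^2^2" where
  "ratio p q x y = gram q x ** inv2 (gram p x) ** gram p y ** inv2 (gram q y)"

definition conj2 :: "real^2^2 \<Rightarrow> real^2^2 \<Rightarrow> real^2^2" where
  "conj2 m U = m ** U ** inv2 m"

text \<open>The changes of frame k, h, r each meet their own inverse and cancel, and g disappears
  inside the pairings. Only the change m of the frame of Q survives, as a conjugation common to all
  ratios.\<close>

lemma ratio_change:
  assumes g: "g \<in> carrier Sp4" and d: "det k \<noteq> 0" "det m \<noteq> 0" "det h \<noteq> 0" "det r \<noteq> 0"
  shows "ratio (g ** p ** k) (g ** q ** m) (g ** x ** h) (g ** y ** r) =
    conj2 (transpose m) (ratio p q x y)"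
proof -
  have "ratio (g ** p ** k) (g ** q ** m) (g ** x ** h) (g ** y ** r) =
    transpose m ** gram q x ** (h ** inv2 h) ** inv2 (gram p x) ** (inv2 (transpose k) ** transpose k)
      ** gram p y ** (r ** inv2 r) ** inv2 (gram q y) ** inv2 (transpose m)"
    by (simp add: ratio_def gram_change[OF g] inv2_mult matrix_mul_assoc)
  also have "\<dots> = conj2 (transpose m) (ratio p q x y)"
    using d by (simp add: inv2_inverse conj2_def ratio_def matrix_mul_assoc)
  finally show ?thesis .
qed

lemma conj2_mult: "det m \<noteq> 0 \<Longrightarrow> conj2 m U ** conj2 m V = conj2 m (U ** V)"
proof -
  assume m: "det m \<noteq> 0"
  have "conj2 m U ** conj2 m V = m ** U ** (inv2 m ** m) ** V ** inv2 m"
    by (simp only: conj2_def matrix_mul_assoc)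
  then show ?thesis by (simp add: inv2_inverse[OF m] conj2_def matrix_mul_assoc)
qed

lemma trace_conj2: "det m \<noteq> 0 \<Longrightarrow> trace (conj2 m U) = trace U"
  using trace_mul_sym[of "m ** U" "inv2 m"] by (simp add: conj2_def matrix_mul_assoc inv2_inverse)

lemma det_conj2: "det m \<noteq> 0 \<Longrightarrow> det (conj2 m U) = det U"
  using arg_cong[OF inv2_inverse(1), of m det] by (simp add: conj2_def det_mul)

definition gap :: "real^2^2 \<Rightarrow> real" where
  "gap U = sqrt ((trace U)\<^sup>2 - 4 * det U)"

definition spectrum2 :: "real^2^2 \<Rightarrow> real \<times> real" where
  "spectrum2 U = ((trace U + gap U) / 2, (trace U - gap U) / 2)"

text \<open>Half the trace of the product of the involutions obtained from the traceless parts of U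
  and V by scaling their eigenvalues to 1 and -1. For reflections with axes at angle \<alpha>/2 the
  product is a rotation by \<alpha>, and the result is cos \<alpha>.\<close>

definition cos_angle :: "real^2^2 \<Rightarrow> real^2^2 \<Rightarrow> real" where
  "cos_angle U V = (2 * trace (U ** V) - trace U * trace V) / (gap U * gap V)"

lemma conj2_invariants:
  assumes "det m \<noteq> 0"
  shows "gap (conj2 m U) = gap U" "spectrum2 (conj2 m U) = spectrum2 U"
    "cos_angle (conj2 m U) (conj2 m V) = cos_angle U V"
  using assms
  by (simp_all add: gap_def spectrum2_def cos_angle_def trace_conj2 det_conj2 conj2_mult)

type_synonym frames =
  "(real^2^4) \<times> (real^2^4) \<times> (real^2^4) \<times> (real^2^4) \<times> (real^2^4) \<times> (real^2^4)"

text \<open>The cross-ratios of the non-generic quadruple and of the two generic ones.\<close>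

definition ratios :: "nat \<Rightarrow> frames \<Rightarrow> (real^2^2) \<times> (real^2^2) \<times> (real^2^2)" where
  "ratios j = (\<lambda>(p, a, b, c, d, q).
     if j = 1 then (ratio p q a b, ratio p q b c, ratio p q c d)
     else if j = 2 then (ratio p q b c, ratio p q a b, ratio p q c d)
     else (ratio p q c d, ratio p q a b, ratio p q b c))"

definition invariants :: "nat \<Rightarrow> frames \<Rightarrow> real \<times> (real \<times> real) \<times> (real \<times> real) \<times> real" where
  "invariants j = (\<lambda>(L, U, V). (trace L / 2, spectrum2 U, spectrum2 V, cos_angle U V)) \<circ> ratios j"

text \<open>Guarantees that no denominator in the invariants vanishes.\<close>

definition regular :: "nat \<Rightarrow> frames \<Rightarrow> bool" where
  "regular j = (\<lambda>(p, a, b, c, d, q).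
     (\<forall>x\<in>{a, b, c, d}. det (gram p x) \<noteq> 0 \<and> det (gram q x) \<noteq> 0) \<and>
     (let (L, U, V) = ratios j (p, a, b, c, d, q) in gap U \<noteq> 0 \<and> gap V \<noteq> 0))"

definition base_change :: "real^4^4 \<Rightarrow> real^2^4 \<Rightarrow> real^2^4 \<Rightarrow> bool" where
  "base_change g F F' \<longleftrightarrow> (\<exists>k. det k \<noteq> 0 \<and> F' = g ** F ** k)"

definition reframing :: "real^4^4 \<Rightarrow> frames \<Rightarrow> frames \<Rightarrow> bool" where
  "reframing g = (\<lambda>(p, a, b, c, d, q) (p', a', b', c', d', q').
     base_change g p p' \<and> base_change g a a' \<and> base_change g b b' \<and> base_change g c c' \<and>
     base_change g d d' \<and> base_change g q q')"

text \<open>All ratio matrices are conjugated by the same matrix, so even the mixed trace in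
  \<open>cos_angle\<close> is preserved.\<close>

lemma reframing_invariants:
  assumes g: "g \<in> carrier Sp4" and r: "reframing g m m'"
  shows "invariants j m' = invariants j m" "regular j m \<Longrightarrow> regular j m'"
proof -
  obtain p a b c d q where m: "m = (p, a, b, c, d, q)" by (metis prod_cases6)
  obtain k1 k2 k3 k4 k5 k6 where d: "det k1 \<noteq> 0" "det k2 \<noteq> 0" "det k3 \<noteq> 0" "det k4 \<noteq> 0" "det k5 \<noteq> 0" "det k6 \<noteq> 0"
    and m': "m' = (g ** p ** k1, g ** a ** k2, g ** b ** k3, g ** c ** k4, g ** d ** k5, g ** q ** k6)"
    using r unfolding reframing_def base_change_def m by (cases m' rule: prod_cases6) auto
  have t: "det (transpose k6) \<noteq> 0" using d by (simp add: det_transpose)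
  show "invariants j m' = invariants j m"
    using d by (simp add: m m' invariants_def ratios_def ratio_change[OF g] trace_conj2[OF t]
        conj2_invariants[OF t] del: det_transpose)
  show "regular j m'" if "regular j m"
    using d that by (simp add: m m' regular_def ratios_def ratio_change[OF g]
        conj2_invariants[OF t] gram_change[OF g] det_mul Let_def split: if_splits)
qed

section \<open>Invariants of the normal form\<close>

definition frames_of :: "real^2^2 \<Rightarrow> real^2^2 \<Rightarrow> real^2^2 \<Rightarrow> frames" where
  "frames_of B C D = (frame 0 (mat 1), frame (mat 1) (mat 1), frame B (mat 1), frame C (mat 1),
     frame D (mat 1), frame (mat 1) 0)"

definition core_frames :: "nat \<Rightarrow> real \<Rightarrow> real^2^2 \<Rightarrow> real^2^2 \<Rightarrow> frames" where
  "core_frames j l M N =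
     (if j = 1 then frames_of (l *\<^sub>R mat 1) (l *\<^sub>R M) (l *\<^sub>R N)
      else if j = 2 then frames_of M (l *\<^sub>R M) (l *\<^sub>R N)
      else frames_of M N (l *\<^sub>R N))"

definition normal_frames :: "nat \<Rightarrow> real \<times> (real \<times> real) \<times> (real \<times> real) \<times> real \<Rightarrow> frames" where
  "normal_frames j = (\<lambda>(l, \<mu>, \<nu>, c). core_frames j l (core_mid \<mu>) (core_top \<mu> \<nu> c))"

lemma inv2_scale: "inv2 (c *\<^sub>R M) = (1 / c) *\<^sub>R inv2 M"
proof -
  have "det (c *\<^sub>R M) = c\<^sup>2 * det M" by (simp add: det_2 power2_eq_square algebra_simps)
  moreover have "adj2 (c *\<^sub>R M) = c *\<^sub>R adj2 M"
    by (simp add: adj2_def trace_def sum_2 vec_eq_iff forall_2 mat_def algebra_simps)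
  ultimately show ?thesis by (simp add: inv2_def power2_eq_square)
qed

lemma ratio_frame:
  "ratio (frame 0 (mat 1)) (frame (mat 1) 0) (frame X (mat 1)) (frame Y (mat 1)) = inv2 X ** Y"
proof -
  have "inv2 (- X) ** (- Y) = inv2 X ** Y"
    using inv2_scale[of "-1" X] scaleR_matrix_mult(1)[of "-1" "inv2 X" "- Y"]
      scaleR_matrix_mult(2)[of "inv2 X" "-1" Y] by simp
  then show ?thesis by (simp add: ratio_def gram_frame transpose_mat)
qed

lemma det_core:
  assumes "core M N" shows "det M \<noteq> 0" "det N \<noteq> 0"
proof -
  have "posdef M" using assms posdef_add[OF posdef_mat_1, of "M - mat 1"] by (simp add: core_def)
  moreover then have "posdef N" using assms posdef_add[of M "N - M"] by (simp add: core_def)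
  moreover have "det S \<noteq> 0" if "posdef S" for S :: "real^2^2"
    using that exists_kernel_iff_det[of S] by (force simp: posdef_def)
  ultimately show "det M \<noteq> 0" "det N \<noteq> 0" by blast+
qed

text \<open>The factor l cancels wherever both neighbouring matrices carry it and appears alone at
  the non-generic step.\<close>

lemma ratios_core_frames:
  assumes "core M N" "1 < l"
  shows "ratios j (core_frames j l M N) = (l *\<^sub>R mat 1, M, inv2 M ** N)"
proof -
  have "inv2 X ** X = mat 1" if "X = M \<or> X = N" for X
    using det_core[OF assms(1)] inv2_inverse(2) that by blast
  then show ?thesis
    using assms(2)
    by (simp add: ratios_def core_frames_def frames_of_def ratio_frame scaleR_matrix_mult inv2_scale)
qed

lemma regular_invariants_normal_frames:
  assumes k: "k \<in> params"
  shows "invariants j (normal_frames j k) = k" "regular j (normal_frames j k)"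
proof -
  obtain l m n v w c where k': "k = (l, (m, n), (v, w), c)" by (metis prod.exhaust)
  with k have l: "1 < l" and mn: "n < m" "1 < n" and vw: "w < v" "1 < w" and c: "-1 \<le> c" "c \<le> 1"
    by (auto simp: params_def spectra_def)
  define M N where "M = core_mid (m, n)" and "N = core_top (m, n) (v, w) c"
  have core: "core M N"
    unfolding M_def N_def using mn vw c by (intro core_core_normal_form) (auto simp: spectra_def)
  have fr: "normal_frames j k = core_frames j l M N"
    by (simp add: normal_frames_def k' M_def N_def)
  \<comment> \<open>Midpoint and half-gap of the second spectrum: V has diagonal s + t c, s - t c,
    and its determinant is free of c.\<close>
  define s t where "s = (v + w) / 2" and "t = (v - w) / 2"
  have st: "v = s + t" "w = s - t" "0 < t" using vw by (simp_all add: s_def t_def field_simps)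
  have "c\<^sup>2 \<le> 1" using c by (simp add: abs_square_le_1 abs_le_iff)
  then have sq: "(sqrt (1 - c\<^sup>2))\<^sup>2 = 1 - c\<^sup>2" "(sqrt (m * n))\<^sup>2 = m * n" using mn by simp_all
  have M: "M = mat2 m 0 n" by (simp add: M_def core_mid_def)
  define b where "b = sqrt (m * n) * t * sqrt (1 - c\<^sup>2)"
  have b2: "b\<^sup>2 = m * n * t\<^sup>2 * (1 - c\<^sup>2)" by (simp add: b_def power_mult_distrib sq)
  have N: "N = mat2 (m * (s + t * c)) b (n * (s - t * c))"
    unfolding N_def core_top_def prod.case b_def s_def[symmetric] t_def[symmetric] ..
  define V where "V = inv2 M ** N"
  have V: "V $ 1 $ 1 = s + t * c" "V $ 1 $ 2 = b / m" "V $ 2 $ 1 = b / n" "V $ 2 $ 2 = s - t * c"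
    using mn
    by (simp_all add: V_def M N inv2_def adj2_def det_mat2 trace_def sum_2 mat_def matrix_matrix_mult_def
        field_simps)
  have trM: "trace M = m + n" "det M = m * n" by (simp_all add: M trace_def sum_2 det_mat2)
  have trV: "trace V = 2 * s" by (simp add: trace_def sum_2 V)
  have "det V = (s + t * c) * (s - t * c) - b\<^sup>2 / (m * n)"
    by (simp add: det_2 V power2_eq_square)
  also have "b\<^sup>2 / (m * n) = t\<^sup>2 * (1 - c\<^sup>2)" using mn by (simp add: b2)
  also have "(s + t * c) * (s - t * c) - t\<^sup>2 * (1 - c\<^sup>2) = s\<^sup>2 - t\<^sup>2"
    by (simp add: power2_eq_square algebra_simps)
  finally have detV: "det V = s\<^sup>2 - t\<^sup>2" .
  have trMV: "trace (M ** V) = m * (s + t * c) + n * (s - t * c)"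
    by (simp add: M trace_def sum_2 matrix_matrix_mult_def V)
  have "(trace M)\<^sup>2 - 4 * det M = (m - n)\<^sup>2"
    by (simp add: trM power2_eq_square algebra_simps)
  then have gM: "gap M = m - n" using mn by (simp add: gap_def)
  have "(trace V)\<^sup>2 - 4 * det V = (2 * t)\<^sup>2"
    by (simp add: trV detV power2_eq_square algebra_simps)
  then have "gap V = sqrt ((2 * t)\<^sup>2)" by (simp only: gap_def)
  also have "\<dots> = 2 * t" unfolding real_sqrt_abs using st by simp
  finally have gV: "gap V = 2 * t" .
  \<comment> \<open>The product M V is N, whose trace contains c with coefficient gap M * gap V / 2;
    the product of the traces removes the rest.\<close>
  have "2 * trace (M ** V) - trace M * trace V = (gap M * gap V) * c"
    by (simp add: trMV trM trV gM gV algebra_simps)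
  then have cos: "cos_angle M V = c" using mn st by (simp add: cos_angle_def gM gV)
  have "trace (l *\<^sub>R mat 1 :: real^2^2) / 2 = l" by (simp add: trace_def sum_2 mat_def)
  moreover have "spectrum2 M = (m, n)" "spectrum2 V = (v, w)"
    by (simp_all add: spectrum2_def gM gV trM trV st)
  ultimately show "invariants j (normal_frames j k) = k"
    by (simp add: fr[unfolded k'] invariants_def ratios_core_frames[OF core l] cos k' flip: V_def)
  have "det (l *\<^sub>R X) \<noteq> 0 \<longleftrightarrow> det X \<noteq> 0" for X :: "real^2^2"
    using l by (simp add: det_2 algebra_simps)
  moreover have "det (- X) = det X" for X :: "real^2^2" by (simp add: det_2)
  moreover have "gap M \<noteq> 0" "gap V \<noteq> 0" using gM gV mn st by auto
  ultimately show "regular j (normal_frames j k)"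
    using l det_core[OF core] ratios_core_frames[OF core l, of j]
    by (auto simp: fr regular_def core_frames_def frames_of_def gram_frame transpose_mat V_def[symmetric])
qed

section \<open>Frames of planes and of hexagons\<close>

definition plane :: "real^2^4 \<Rightarrow> (real^4) set" where
  "plane F = span (columns F)"

definition planes :: "frames \<Rightarrow> hexagon" where
  "planes = map_prod plane (map_prod plane (map_prod plane (map_prod plane (map_prod plane plane))))"

definition frame_space :: "(real^2^4) set" where
  "frame_space = {F. rank F = 2}"

lemma frame_space_inj: "F \<in> frame_space \<longleftrightarrow> inj ((*v) F)"
  using full_rank_injective[of F] by (simp add: frame_space_def)

lemma plane_eq_range: "plane F = range ((*v) F)"
  by (simp add: plane_def span_columns)

text \<open>The columns of k express those of F' in terms of g F, and injectivity of F' forces k to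
  be invertible.\<close>

lemma plane_image_imp_base_change:
  assumes F': "F' \<in> frame_space" and eq: "plane F' = (*v) g ` plane F"
  shows "base_change g F F'"
proof -
  have "\<exists>w. F' *v x = g *v (F *v w)" for x
    using eq unfolding plane_eq_range by blast
  then obtain w where w: "F' *v x = g *v (F *v w x)" for x by metis
  define k :: "real^2^2" where "k = (\<chi> i j. w (axis j 1) $ i)"
  have "k *v axis j 1 = w (axis j 1)" for j
    by (simp add: k_def matrix_vector_mult_basis column_def)
  then have "(g ** F ** k) *v axis j 1 = F' *v axis j 1" for j
    by (simp add: w flip: matrix_vector_mul_assoc)
  then have F'_eq: "F' = g ** F ** k"
    by (simp add: matrix_vector_mult_basis column_def vec_eq_iff)
  have "x = 0" if "k *v x = 0" for x
  proof -
    have "F' *v x = 0" by (simp add: F'_eq that flip: matrix_vector_mul_assoc)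
    then show ?thesis using F' unfolding frame_space_inj by (metis injD matrix_vector_mult_0_right)
  qed
  then have "det k \<noteq> 0" using exists_kernel_iff_det[of k] by blast
  with F'_eq show ?thesis by (auto simp: base_change_def)
qed

lemma planes_image_imp_reframing:
  assumes "m' \<in> frame_space \<times> frame_space \<times> frame_space \<times> frame_space \<times> frame_space \<times> frame_space"
    "planes m' = hexagon_image g (planes m)"
  shows "reframing g m m'"
  using assms
  by (cases m rule: prod_cases6; cases m' rule: prod_cases6)
    (auto simp: reframing_def planes_def hexagon_image_def intro: plane_image_imp_base_change)

lemma planes_normal_frames: "planes (normal_frames j k) = normal_hexagon j k"
  by (cases k rule: prod_cases4)
    (simp add: normal_frames_def normal_hexagon_def core_frames_def core_hexagon_def frames_of_def
      hexagon_of_def planes_def plane_def flip: lag_mat_columns lag_inf_columns)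

lemma normal_frames_frame_space:
  "normal_frames j k \<in> frame_space \<times> frame_space \<times> frame_space \<times> frame_space \<times> frame_space \<times> frame_space"
  by (cases k rule: prod_cases4)
    (simp add: normal_frames_def core_frames_def frames_of_def frame_space_inj del: frame_mult)

section \<open>Topology of the quotients\<close>

lemma quotient_map_quotient_topology: "quotient_map T (quotient_topology T f) f"
  by (simp add: quotient_map_def openin_quotient_topology)

text \<open>f descends to a continuous map on \<open>Y\<close>, and \<open>g \<circ> s\<close> is
  its inverse, so the section supplies continuity of the inverse. It serves both the orbit space and
  the angle space.\<close>

lemma homeomorphic_space_quotient_section:
  assumes g: "quotient_map X Y g" and f: "continuous_map X Z f" and s: "continuous_map Z X s"
    and fs: "\<And>z. z \<in> topspace Z \<Longrightarrow> f (s z) = z"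
    and fibres: "\<And>x y. x \<in> topspace X \<Longrightarrow> y \<in> topspace X \<Longrightarrow> g x = g y \<longleftrightarrow> f x = f y"
  shows "Y homeomorphic_space Z"
proof -
  obtain h where h: "continuous_map Y Z h" "\<And>x. x \<in> topspace X \<Longrightarrow> h (g x) = f x"
    using quotient_map_lift_exists[OF g f] fibres by metis
  have sX: "s z \<in> topspace X" if "z \<in> topspace Z" for z
    using s that by (auto simp: continuous_map_def)
  have fZ: "f x \<in> topspace Z" if "x \<in> topspace X" for x
    using f that by (auto simp: continuous_map_def)
  have "homeomorphic_maps Y Z h (g \<circ> s)"
    unfolding homeomorphic_maps_def
  proof (intro conjI ballI)
    show "continuous_map Z Y (g \<circ> s)"
      using s g by (intro continuous_map_compose) (auto simp: quotient_imp_continuous_map)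
  next
    fix y assume "y \<in> topspace Y"
    then obtain x where x: "x \<in> topspace X" "y = g x"
      using quotient_imp_surjective_map[OF g] by blast
    then have "g (s (f x)) = g x" by (simp add: fibres fs sX fZ)
    then show "(g \<circ> s) (h y) = y" using x h(2) by simp
  qed (use h fs sX in auto)
  then show ?thesis by (rule homeomorphic_maps_imp_homeomorphic_space)
qed

text \<open>The analogue for quotient maps fails in general; this is what allows six Grassmannians
  at once.\<close>

lemma open_map_map_prod:
  assumes f: "open_map X X' f" and g: "open_map Y Y' g"
  shows "open_map (prod_topology X Y) (prod_topology X' Y') (map_prod f g)"
  unfolding open_map_def
proof (intro allI impI)
  fix W assume W: "openin (prod_topology X Y) W"
  show "openin (prod_topology X' Y') (map_prod f g ` W)"
    unfolding openin_prod_topology_alt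
  proof (intro allI impI)
    fix x' y' assume "(x', y') \<in> map_prod f g ` W"
    then obtain x y where xy: "(x, y) \<in> W" "x' = f x" "y' = g y" by auto
    then obtain U V where UV: "openin X U" "openin Y V" "x \<in> U" "y \<in> V" "U \<times> V \<subseteq> W"
      using W unfolding openin_prod_topology_alt by metis
    have "f ` U \<times> g ` V \<subseteq> map_prod f g ` W"
      using image_mono[OF UV(5), of "map_prod f g"] by (simp add: map_prod_surj_on)
    then show "\<exists>U V. openin X' U \<and> openin Y' V \<and> x' \<in> U \<and> y' \<in> V \<and> U \<times> V \<subseteq> map_prod f g ` W"
      using UV f g xy by (intro exI[of _ "f ` U"] exI[of _ "g ` V"]) (auto simp: open_map_def)
  qed
qed

lemma continuous_map_map_prod:
  assumes "continuous_map X X' f" "continuous_map Y Y' g"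
  shows "continuous_map (prod_topology X Y) (prod_topology X' Y') (map_prod f g)"
  using assms by (simp add: map_prod_def continuous_map_prod_top)

lemma prod_topology_swap_left:
  "prod_topology X (prod_topology Y Z) homeomorphic_space prod_topology Y (prod_topology X Z)"
proof -
  have cont: "continuous_map (prod_topology X (prod_topology Y Z)) (prod_topology Y (prod_topology X Z))
      (\<lambda>p. (fst (snd p), (fst p, snd (snd p))))"
    for X :: "'d topology" and Y :: "'e topology" and Z :: "'f topology"
    using continuous_map_compose[OF continuous_map_snd continuous_map_fst, of X Y Z]
      continuous_map_compose[OF continuous_map_snd continuous_map_snd, of X Y Z]
    by (simp add: continuous_map_paired continuous_map_fst o_def)
  have "homeomorphic_maps (prod_topology X (prod_topology Y Z)) (prod_topology Y (prod_topology X Z))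
      (\<lambda>p. (fst (snd p), (fst p, snd (snd p)))) (\<lambda>p. (fst (snd p), (fst p, snd (snd p))))"
    using cont[of X Y Z] cont[of Y X Z] by (auto simp: homeomorphic_maps_def)
  then show ?thesis by (rule homeomorphic_maps_imp_homeomorphic_space)
qed

section \<open>Continuity of the invariants and of the section\<close>

lemma continuous_on_matrix_mult:
  fixes f :: "'a::topological_space \<Rightarrow> real^'n^'m" and g :: "'a \<Rightarrow> real^'k^'n"
  assumes "continuous_on S f" "continuous_on S g"
  shows "continuous_on S (\<lambda>x. f x ** g x)"
  unfolding matrix_matrix_mult_def by (intro continuous_intros assms)

lemma continuous_on_trace:
  fixes f :: "'a::topological_space \<Rightarrow> real^'n^'n"
  assumes "continuous_on S f" shows "continuous_on S (\<lambda>x. trace (f x))"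
  unfolding trace_def by (intro continuous_intros assms)

lemma continuous_on_det:
  fixes f :: "'a::topological_space \<Rightarrow> real^2^2"
  assumes "continuous_on S f" shows "continuous_on S (\<lambda>x. det (f x))"
  unfolding det_2 by (intro continuous_intros assms)

lemma continuous_on_inv2:
  assumes "continuous_on S f" "\<And>x. x \<in> S \<Longrightarrow> det (f x) \<noteq> 0"
  shows "continuous_on S (\<lambda>x. inv2 (f x))"
  unfolding inv2_def adj2_def
  by (intro continuous_intros continuous_on_det continuous_on_trace assms) (use assms in auto)

lemma continuous_on_gram:
  assumes "continuous_on S f" "continuous_on S g" shows "continuous_on S (\<lambda>x. gram (f x) (g x))"
  unfolding gram_def transpose_def by (intro continuous_on_matrix_mult continuous_intros assms)

lemma continuous_on_ratio:
  assumes "continuous_on S p" "continuous_on S q" "continuous_on S x" "continuous_on S y"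
    and "\<And>m. m \<in> S \<Longrightarrow> det (gram (p m) (x m)) \<noteq> 0" "\<And>m. m \<in> S \<Longrightarrow> det (gram (q m) (y m)) \<noteq> 0"
  shows "continuous_on S (\<lambda>m. ratio (p m) (q m) (x m) (y m))"
  unfolding ratio_def
  by (intro continuous_on_matrix_mult continuous_on_inv2 continuous_on_gram assms)

lemma continuous_on_gap:
  assumes "continuous_on S f" shows "continuous_on S (\<lambda>x. gap (f x))"
  unfolding gap_def by (intro continuous_intros continuous_on_det continuous_on_trace assms)

lemma continuous_on_spectrum2:
  assumes "continuous_on S f" shows "continuous_on S (\<lambda>x. spectrum2 (f x))"
  unfolding spectrum2_def by (intro continuous_intros continuous_on_trace continuous_on_gap assms) auto

lemma continuous_on_cos_angle:
  assumes "continuous_on S f" "continuous_on S g"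
    "\<And>x. x \<in> S \<Longrightarrow> gap (f x) \<noteq> 0" "\<And>x. x \<in> S \<Longrightarrow> gap (g x) \<noteq> 0"
  shows "continuous_on S (\<lambda>x. cos_angle (f x) (g x))"
  unfolding cos_angle_def
  by (intro continuous_intros continuous_on_trace continuous_on_gap continuous_on_matrix_mult assms)
    (use assms in auto)

lemma continuous_on_invariants:
  assumes reg: "\<And>m. m \<in> S \<Longrightarrow> regular j m"
  shows "continuous_on S (invariants j)"
proof -
  define p a b c d q :: "frames \<Rightarrow> real^2^4" where "p = fst" and "a = (\<lambda>m. fst (snd m))"
    and "b = (\<lambda>m. fst (snd (snd m)))" and "c = (\<lambda>m. fst (snd (snd (snd m))))"
    and "d = (\<lambda>m. fst (snd (snd (snd (snd m)))))" and "q = (\<lambda>m. snd (snd (snd (snd (snd m)))))"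
  have cont: "continuous_on S p" "continuous_on S a" "continuous_on S b" "continuous_on S c"
      "continuous_on S d" "continuous_on S q"
    unfolding p_def a_def b_def c_def d_def q_def by (intro continuous_intros)+
  have m: "m = (p m, a m, b m, c m, d m, q m)" for m
    by (simp add: p_def a_def b_def c_def d_def q_def)
  define L U V where "L = (\<lambda>m. fst (ratios j m))" and "U = (\<lambda>m. fst (snd (ratios j m)))"
    and "V = (\<lambda>m. snd (snd (ratios j m)))"
  have ratios: "ratios j m =
     (if j = 1 then (ratio (p m) (q m) (a m) (b m), ratio (p m) (q m) (b m) (c m), ratio (p m) (q m) (c m) (d m))
     else if j = 2 then (ratio (p m) (q m) (b m) (c m), ratio (p m) (q m) (a m) (b m), ratio (p m) (q m) (c m) (d m))
     else (ratio (p m) (q m) (c m) (d m), ratio (p m) (q m) (a m) (b m), ratio (p m) (q m) (b m) (c m)))" for m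
    by (subst m) (simp add: ratios_def)
  have reg': "x \<in> {a, b, c, d} \<Longrightarrow> det (gram (p m) (x m)) \<noteq> 0"
      "x \<in> {a, b, c, d} \<Longrightarrow> det (gram (q m) (x m)) \<noteq> 0" "gap (U m) \<noteq> 0" "gap (V m) \<noteq> 0"
    if "m \<in> S" for m x
  proof -
    have "regular j (p m, a m, b m, c m, d m, q m)" using reg[OF that] m by metis
    then have r: "(\<forall>x\<in>{a m, b m, c m, d m}. det (gram (p m) x) \<noteq> 0 \<and> det (gram (q m) x) \<noteq> 0) \<and>
       (let (L, U, V) = ratios j m in gap U \<noteq> 0 \<and> gap V \<noteq> 0)"
      unfolding regular_def prod.case by (simp only: m[symmetric] simp_thms) (elim conjE)
    then show "x \<in> {a, b, c, d} \<Longrightarrow> det (gram (p m) (x m)) \<noteq> 0"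
      "x \<in> {a, b, c, d} \<Longrightarrow> det (gram (q m) (x m)) \<noteq> 0" "gap (U m) \<noteq> 0" "gap (V m) \<noteq> 0"
      by (auto simp: U_def V_def case_prod_unfold Let_def)
  qed
  have "continuous_on S (\<lambda>m. ratio (p m) (q m) (a m) (b m))"
    "continuous_on S (\<lambda>m. ratio (p m) (q m) (b m) (c m))"
    "continuous_on S (\<lambda>m. ratio (p m) (q m) (c m) (d m))"
    by (intro continuous_on_ratio cont reg'; simp)+
  then have LUV: "continuous_on S L" "continuous_on S U" "continuous_on S V"
    unfolding L_def U_def V_def ratios by (cases "j = 1"; cases "j = 2"; simp)+
  have "invariants j = (\<lambda>m. (trace (L m) / 2, spectrum2 (U m), spectrum2 (V m), cos_angle (U m) (V m)))"
    by (simp add: invariants_def fun_eq_iff L_def U_def V_def case_prod_unfold)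
  then show ?thesis
    using LUV reg'(3,4)
    by (simp add: continuous_on_Pair continuous_on_divide continuous_on_trace continuous_on_spectrum2
        continuous_on_cos_angle)
qed

lemma continuous_on_mat2:
  assumes "continuous_on S p" "continuous_on S q" "continuous_on S r"
  shows "continuous_on S (\<lambda>x. mat2 (p x) (q x) (r x))"
proof -
  have eq: "(\<lambda>x. mat2 (p x) (q x) (r x)) =
      (\<lambda>x. p x *\<^sub>R mat2 1 0 0 + q x *\<^sub>R mat2 0 1 0 + r x *\<^sub>R mat2 0 0 1)"
    by (simp add: mat2_arith)
  show ?thesis unfolding eq by (intro continuous_intros assms)
qed

lemma continuous_on_frame:
  assumes "continuous_on S f" shows "continuous_on S (\<lambda>x. frame (f x) T)"
proof -
  have eq: "(\<lambda>x. frame (f x) T) = (\<lambda>x. frame (mat 1) 0 ** f x + frame 0 T)"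
    by (simp add: fun_eq_iff vec_eq_iff forall_4 forall_2 matrix_matrix_mult_def sum_2 mat_def)
  show ?thesis
    unfolding eq by (intro continuous_on_add continuous_on_matrix_mult assms continuous_on_const)
qed

lemma continuous_on_normal_frames: "continuous_on S (normal_frames j)"
proof -
  define M where "M = (\<lambda>k :: real \<times> (real \<times> real) \<times> (real \<times> real) \<times> real. core_mid (fst (snd k)))"
  define N where "N = (\<lambda>k :: real \<times> (real \<times> real) \<times> (real \<times> real) \<times> real.
      core_top (fst (snd k)) (fst (snd (snd k))) (snd (snd (snd k))))"
  have "continuous_on S M"
    unfolding M_def core_mid_def case_prod_unfold by (intro continuous_on_mat2 continuous_intros)
  moreover have "continuous_on S N"
    unfolding N_def core_top_def case_prod_unfold by (intro continuous_on_mat2 continuous_intros) auto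
  moreover have "normal_frames j = (\<lambda>k. core_frames j (fst k) (M k) (N k))"
    by (simp add: normal_frames_def M_def N_def case_prod_unfold)
  ultimately show ?thesis
    by (cases "j = 1"; cases "j = 2"; simp add: core_frames_def frames_of_def;
        intro continuous_on_Pair continuous_on_frame continuous_on_scaleR continuous_on_fst
          continuous_on_id continuous_on_const)
qed

section \<open>Openness of the projection from frames to planes\<close>

abbreviation hexagon_frames :: "frames set" where
  "hexagon_frames \<equiv>
    frame_space \<times> frame_space \<times> frame_space \<times> frame_space \<times> frame_space \<times> frame_space"

lemma grass_altdef: "grass = quotient_topology (top_of_set frame_space) plane"
  by (simp add: grass_def frame_space_def plane_def[abs_def])

text \<open>Frames of one plane differ by right multiplication with a matrix, so the saturation of
  an open set is a union of preimages under such multiplications.\<close>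

lemma open_map_plane: "open_map (top_of_set frame_space) grass plane"
  unfolding open_map_def
proof (intro allI impI)
  fix U assume U: "openin (top_of_set frame_space) U"
  then have sub: "U \<subseteq> frame_space" by (simp add: openin_imp_subset)
  \<comment> \<open>k runs over all matrices; a singular k contributes the empty set, because F ** k
    is then not a frame.\<close>
  define W where "W k = {F \<in> frame_space. F ** k \<in> U}" for k :: "real^2^2"
  have "openin (top_of_set frame_space) (W k)" for k
  proof -
    obtain T where T: "open T" "U = frame_space \<inter> T" using U by (auto simp: openin_open)
    have "continuous_on UNIV (\<lambda>F :: real^2^4. F ** k)"
      by (intro continuous_on_matrix_mult continuous_intros)
    then have open_T: "open {F :: real^2^4. F ** k \<in> T}"
      using open_vimage[OF T(1), of "\<lambda>F. F ** k"] by (simp add: vimage_def)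
    show ?thesis
    proof (cases "det k = 0")
      case True
      then obtain x where x: "x \<noteq> 0" "k *v x = 0" using exists_kernel_iff_det[of k] by blast
      have "F ** k \<notin> frame_space" for F :: "real^2^4"
      proof
        assume "F ** k \<in> frame_space"
        moreover have "(F ** k) *v x = (F ** k) *v 0" by (simp add: x flip: matrix_vector_mul_assoc)
        ultimately show False using x(1) by (metis frame_space_inj injD)
      qed
      then have "W k = {}" using sub by (auto simp: W_def)
      then show ?thesis by simp
    next
      case False
      have "F ** k \<in> frame_space" if "F \<in> frame_space" for F :: "real^2^4"
      proof -
        have "inj ((*v) k)"
          using False exists_kernel_iff_det[of k]
          by (metis matrix_left_invertible_injective matrix_left_invertible_ker)
        moreover have "(*v) (F ** k) = (*v) F \<circ> (*v) k"
          by (simp add: fun_eq_iff matrix_vector_mul_assoc)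
        ultimately show ?thesis using that by (simp add: frame_space_inj inj_compose)
      qed
      then have "W k = frame_space \<inter> {F. F ** k \<in> T}" by (auto simp: W_def T(2))
      then show ?thesis using open_T by (auto simp: openin_open)
    qed
  qed
  moreover have "{F \<in> topspace (top_of_set frame_space). plane F \<in> plane ` U} = (\<Union>k. W k)"
  proof (intro subset_antisym subsetI)
    fix F assume "F \<in> {F \<in> topspace (top_of_set frame_space). plane F \<in> plane ` U}"
    then obtain G where G: "G \<in> U" "plane F = plane G" and F: "F \<in> frame_space" by auto
    then have "base_change (mat 1) F G"
      using sub by (intro plane_image_imp_base_change) auto
    then obtain k where "G = F ** k" by (auto simp: base_change_def)
    with F G show "F \<in> (\<Union>k. W k)" by (auto simp: W_def)
  next
    fix F assume "F \<in> (\<Union>k. W k)"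
    then obtain k where k: "F \<in> frame_space" "F ** k \<in> U" by (auto simp: W_def)
    have "plane (F ** k) = plane F"
    proof (rule subspace_dim_equal)
      show "plane (F ** k) \<subseteq> plane F"
        by (auto simp: plane_eq_range simp flip: matrix_vector_mul_assoc)
      have "F ** k \<in> frame_space" using k sub by blast
      then show "dim (plane F) \<le> dim (plane (F ** k))"
        using k by (simp add: plane_eq_range frame_space_def rank_dim_range)
    qed (simp_all add: plane_def)
    with k show "F \<in> {F \<in> topspace (top_of_set frame_space). plane F \<in> plane ` U}"
      by (auto intro!: image_eqI[of _ _ "F ** k"])
  qed
  ultimately show "openin grass (plane ` U)"
    using sub unfolding grass_altdef openin_quotient_topology by (auto intro!: openin_Union)
qed

lemma
  shows open_map_planes: "open_map (top_of_set hexagon_frames) hexagon_topology planes"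
    and continuous_map_planes: "continuous_map (top_of_set hexagon_frames) hexagon_topology planes"
proof -
  have cont: "continuous_map (top_of_set frame_space) grass plane"
    unfolding grass_altdef by (intro quotient_imp_continuous_map quotient_map_quotient_topology)
  show "open_map (top_of_set hexagon_frames) hexagon_topology planes"
    unfolding planes_def hexagon_topology_def prod_topology_subtopology_eu[symmetric]
    by (intro open_map_map_prod open_map_plane)
  show "continuous_map (top_of_set hexagon_frames) hexagon_topology planes"
    unfolding planes_def hexagon_topology_def prod_topology_subtopology_eu[symmetric]
    by (intro continuous_map_map_prod cont)
qed

lemma nongeneric_hexagon_planes:
  assumes "H \<in> nongeneric_hexagons j" obtains m where "m \<in> hexagon_frames" "planes m = H"
proof -
  obtain g k where g: "g \<in> carrier Sp4" and H: "H = hexagon_image g (normal_hexagon j k)"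
    using assms nongeneric_hexagons_iff by blast
  define m where "m = map_prod ((**) g) (map_prod ((**) g) (map_prod ((**) g) (map_prod ((**) g)
      (map_prod ((**) g) ((**) g))))) (normal_frames j k)"
  have "g ** F \<in> frame_space" if "F \<in> frame_space" for F
  proof -
    have "(*v) (g ** F) = (*v) g \<circ> (*v) F" by (simp add: fun_eq_iff matrix_vector_mul_assoc)
    then show ?thesis using that Sp4_inj[OF g] by (simp add: frame_space_inj inj_compose)
  qed
  then have "m \<in> hexagon_frames"
    using normal_frames_frame_space[of j k]
    by (cases "normal_frames j k" rule: prod_cases6) (simp add: m_def)
  moreover have "plane (g ** F) = (*v) g ` plane F" for F
    by (simp add: plane_eq_range image_image flip: matrix_vector_mul_assoc)
  then have "planes m = hexagon_image g (planes (normal_frames j k))"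
    by (cases "normal_frames j k" rule: prod_cases6) (simp add: m_def planes_def hexagon_image_def)
  ultimately show ?thesis using that H by (simp add: planes_normal_frames)
qed

text \<open>Openness passes to the restriction over any subset of the target, and a continuous open
  surjection is a quotient map.\<close>

lemma quotient_map_planes:
  "quotient_map (top_of_set {m \<in> hexagon_frames. planes m \<in> nongeneric_hexagons j})
     (subtopology hexagon_topology (nongeneric_hexagons j)) planes"
proof (rule continuous_open_imp_quotient_map)
  let ?W = "{m \<in> hexagon_frames. planes m \<in> nongeneric_hexagons j}"
  have eq: "top_of_set ?W = subtopology (top_of_set hexagon_frames) ?W"
    by (simp add: subtopology_subtopology Int_absorb1 Collect_restrict)
  show "open_map (top_of_set ?W) (subtopology hexagon_topology (nongeneric_hexagons j)) planes"
    unfolding eq by (rule open_map_restriction[OF open_map_planes]) auto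
  show "continuous_map (top_of_set ?W) (subtopology hexagon_topology (nongeneric_hexagons j)) planes"
    unfolding eq continuous_map_in_subtopology
    using continuous_map_from_subtopology[OF continuous_map_planes] by auto
  have "nongeneric_hexagons j \<subseteq> planes ` ?W"
  proof
    fix H assume H: "H \<in> nongeneric_hexagons j"
    then obtain m where "m \<in> hexagon_frames" "planes m = H" by (rule nongeneric_hexagon_planes)
    with H show "H \<in> planes ` ?W" by blast
  qed
  moreover have "planes ` ?W \<subseteq> topspace hexagon_topology"
    using continuous_map_planes by (auto simp: continuous_map_def)
  ultimately show "planes ` topspace (top_of_set ?W) =
      topspace (subtopology hexagon_topology (nongeneric_hexagons j))"
    by auto
qed

section \<open>The orbit space and its parameters\<close>

text \<open>The cosets are the pairs g, -g, which act alike on subspaces, so orbits of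
  \<open>PSp4\<close> are orbits of symplectic matrices.\<close>

lemma psp_orbit_planes: "psp_orbit (planes m) = {hexagon_image g (planes m) | g. g \<in> carrier Sp4}"
proof -
  have coset: "{mat 1, - mat 1} #>\<^bsub>Sp4\<^esub> g = {g, - g}" for g
    by (auto simp: r_coset_def Sp4_def matrix_mul_minus)
  have "psp_act {g, - g} (plane F) = (*v) g ` plane F" for g F
  proof -
    have "(- g) *v x = g *v (- x)" for x
      using scaleR_matrix_vector_assoc[of "-1" g x] matrix_vector_mult_scaleR[of g "-1" x] by simp
    moreover have "- x \<in> plane F" if "x \<in> plane F" for x
      using that by (simp add: plane_def span_neg)
    ultimately show ?thesis by (auto simp: psp_act_def)
  qed
  then have "psp_act_hexagon {g, - g} (planes m) = hexagon_image g (planes m)" for g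
    by (cases m rule: prod_cases6) (simp add: psp_act_hexagon_def planes_def hexagon_image_def)
  then show ?thesis
    by (auto simp: psp_orbit_def PSp4_def FactGroup_def RCOSETS_def coset) (metis coset)+
qed

text \<open>Works with the composite projection from frames to orbits: \<open>invariants\<close> is
  constant on its fibres and separates them, and \<open>normal_frames\<close> is a section of
  \<open>invariants\<close>.\<close>

lemma nongeneric_hexagons_homeomorphic_params:
  "mod_PSp4 (nongeneric_hexagons j) homeomorphic_space top_of_set params"
proof -
  define W where "W = {m \<in> hexagon_frames. planes m \<in> nongeneric_hexagons j}"
  \<comment> \<open>The parameters of a normal form are recovered as invariants of any frames, so
    they are unique and regularity is inherited.\<close>
  have normal: "\<exists>g\<in>carrier Sp4. planes m = hexagon_image g (normal_hexagon j (invariants j m)) \<and>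
      invariants j m \<in> params \<and> regular j m" if "m \<in> W" for m
  proof -
    obtain g k where g: "g \<in> carrier Sp4" and k: "k \<in> params"
      and eq: "planes m = hexagon_image g (normal_hexagon j k)"
      using \<open>m \<in> W\<close> nongeneric_hexagons_iff unfolding W_def by blast
    then have "reframing g (normal_frames j k) m"
      using \<open>m \<in> W\<close> by (intro planes_image_imp_reframing) (simp_all add: W_def planes_normal_frames)
    then have "invariants j m = k" "regular j m"
      using reframing_invariants[OF g] regular_invariants_normal_frames[OF k] by metis+
    with g k eq show ?thesis by blast
  qed
  have "quotient_map (top_of_set W) (mod_PSp4 (nongeneric_hexagons j)) (psp_orbit \<circ> planes)"
    unfolding mod_PSp4_def W_def
    by (rule quotient_map_compose[OF quotient_map_planes quotient_map_quotient_topology])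
  then show ?thesis
  proof (rule homeomorphic_space_quotient_section)
    show "continuous_map (top_of_set W) (top_of_set params) (invariants j)"
      using normal continuous_on_invariants[of W j] by auto
    have "normal_frames j k \<in> W" if "k \<in> params" for k
    proof -
      have "mat 1 \<in> carrier Sp4" by (simp add: carrier_Sp4_iff)
      then have "normal_hexagon j k \<in> nongeneric_hexagons j"
        using that nongeneric_hexagons_iff[of "normal_hexagon j k" j]
        by (metis hexagon_image_mat_1)
      then show ?thesis
        using normal_frames_frame_space[of j k] by (simp add: W_def planes_normal_frames)
    qed
    then show "continuous_map (top_of_set params) (top_of_set W) (normal_frames j)"
      using continuous_on_normal_frames[of params j] by auto
    show "invariants j (normal_frames j k) = k" if "k \<in> topspace (top_of_set params)" for k
      using that by (simp add: regular_invariants_normal_frames)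
  next
    fix m m' assume "m \<in> topspace (top_of_set W)" "m' \<in> topspace (top_of_set W)"
    then have m: "m \<in> W" "m' \<in> W" by simp_all
    show "(psp_orbit \<circ> planes) m = (psp_orbit \<circ> planes) m' \<longleftrightarrow> invariants j m = invariants j m'"
    proof
      assume "(psp_orbit \<circ> planes) m = (psp_orbit \<circ> planes) m'"
      moreover have "planes m' \<in> psp_orbit (planes m')"
      proof -
        have "mat 1 \<in> carrier Sp4" by (simp add: carrier_Sp4_iff)
        then show ?thesis unfolding psp_orbit_planes by (metis (mono_tags, lifting) hexagon_image_mat_1 mem_Collect_eq)
      qed
      ultimately have "planes m' \<in> psp_orbit (planes m)" by simp
      then obtain g where g: "g \<in> carrier Sp4" "planes m' = hexagon_image g (planes m)"
        unfolding psp_orbit_planes by blast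
      then have "reframing g m m'"
        using m by (intro planes_image_imp_reframing) (simp_all add: W_def)
      then show "invariants j m = invariants j m'" using reframing_invariants(1)[OF g(1)] by metis
    next
      assume eq: "invariants j m = invariants j m'"
      obtain g g' where g: "g \<in> carrier Sp4" "planes m = hexagon_image g (normal_hexagon j (invariants j m))"
        "g' \<in> carrier Sp4" "planes m' = hexagon_image g' (normal_hexagon j (invariants j m))"
        using normal m eq by metis
      \<comment> \<open>Two hexagons with a common normal form \<open>H\<close>: every image of the
        first is an image of the second, through the inverse of g2.\<close>
      have sub: "psp_orbit (planes m1) \<subseteq> psp_orbit (planes m2)"
        if g12: "g1 \<in> carrier Sp4" "planes m1 = hexagon_image g1 H" "g2 \<in> carrier Sp4"
          "planes m2 = hexagon_image g2 H" for m1 m2 g1 g2 H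
      proof -
        obtain i where i: "i \<in> carrier Sp4" "i ** g2 = mat 1" by (rule Sp4_inverse[OF g12(3)])
        have "H = hexagon_image i (planes m2)"
          by (simp add: g12(4) i flip: hexagon_image_mult)
        then have "planes m1 = hexagon_image (g1 ** i) (planes m2)"
          by (simp add: g12(2) hexagon_image_mult)
        then have "hexagon_image h (planes m1) = hexagon_image (h ** (g1 ** i)) (planes m2)" for h
          by (simp add: hexagon_image_mult)
        then show ?thesis
          unfolding psp_orbit_planes using Sp4_mult g12(1) i(1) by blast
      qed
      show "(psp_orbit \<circ> planes) m = (psp_orbit \<circ> planes) m'"
        using sub[OF g] sub[OF g(3,4,1,2)] by simp
    qed
  qed
qed

lemma cos_eq_iff_angle_rel:
  assumes "\<alpha> \<in> {0..<2*pi}" "\<beta> \<in> {0..<2*pi}"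
  shows "cos \<alpha> = cos \<beta> \<longleftrightarrow> (\<alpha>, \<beta>) \<in> angle_rel"
proof
  assume eq: "cos \<alpha> = cos \<beta>"
  \<comment> \<open>The representative in [0, pi], where cos is injective. The class of 0 is a
    singleton, since 2 pi lies outside the domain.\<close>
  define fold where "fold \<gamma> = (if \<gamma> \<le> pi then \<gamma> else 2 * pi - \<gamma>)" for \<gamma>
  have "cos (fold \<gamma>) = cos \<gamma>" for \<gamma> by (simp add: fold_def)
  moreover have "0 \<le> fold \<gamma> \<and> fold \<gamma> \<le> pi" if "\<gamma> \<in> {0..<2*pi}" for \<gamma>
    using that by (auto simp: fold_def)
  ultimately have "fold \<alpha> = fold \<beta>" using assms eq by (metis cos_inj_pi)
  then show "(\<alpha>, \<beta>) \<in> angle_rel"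
    using assms by (auto simp: angle_rel_def fold_def split: if_splits)
next
  assume "(\<alpha>, \<beta>) \<in> angle_rel"
  then show "cos \<alpha> = cos \<beta>" by (auto simp: angle_rel_def)
qed

text \<open>The half-open interval is not compact, so continuity of the inverse comes from the
  section \<open>arccos\<close>, whose values lie in [0, pi].\<close>

lemma angle_space_homeomorphic: "angle_space homeomorphic_space top_of_set {-1..1::real}"
proof (rule homeomorphic_space_quotient_section)
  show "quotient_map (top_of_set {0..<2*pi}) angle_space (\<lambda>\<alpha>. angle_rel `` {\<alpha>})"
    unfolding angle_space_def by (rule quotient_map_quotient_topology)
  show "continuous_map (top_of_set {0..<2*pi}) (top_of_set {-1..1}) cos"
    by (auto intro: continuous_intros)
  have "0 \<le> arccos c \<and> arccos c < 2 * pi" if "-1 \<le> c" "c \<le> 1" for c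
    using arccos_lbound[OF that] arccos_ubound[OF that] pi_gt_zero by linarith
  then show "continuous_map (top_of_set {-1..1}) (top_of_set {0..<2*pi}) arccos"
    by (auto intro: continuous_on_arccos')
  show "cos (arccos c) = c" if "c \<in> topspace (top_of_set {-1..1})" for c
    using that by simp
  show "angle_rel `` {\<alpha>} = angle_rel `` {\<beta>} \<longleftrightarrow> cos \<alpha> = cos \<beta>"
    if "\<alpha> \<in> topspace (top_of_set {0..<2*pi})" "\<beta> \<in> topspace (top_of_set {0..<2*pi})" for \<alpha> \<beta>
    using that by (simp add: cos_eq_iff_angle_rel eq_equiv_class_iff[OF equiv_angle_rel])
qed

lemma aa_homeomorphic: "top_of_set aa homeomorphic_space top_of_set spectra"
proof -
  have "homeomorphic_maps (top_of_set aa) (top_of_set spectra)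
     (\<lambda>x. (exp (fst x), exp (snd x))) (\<lambda>x. (ln (fst x), ln (snd x)))"
    unfolding homeomorphic_maps_def
    by (auto simp: aa_def spectra_def intro!: continuous_intros)
  then show ?thesis by (rule homeomorphic_maps_imp_homeomorphic_space)
qed

lemma dd_homeomorphic: "top_of_set dd homeomorphic_space top_of_set {(1::real)<..}"
proof -
  have "homeomorphic_maps (top_of_set dd) (top_of_set {1<..})
     (\<lambda>x. exp (fst x)) (\<lambda>x. (ln x, ln x))"
    unfolding homeomorphic_maps_def
    by (auto simp: dd_def intro!: continuous_intros)
  then show ?thesis by (rule homeomorphic_maps_imp_homeomorphic_space)
qed

theorem proposition4p20:
  shows "(mod_PSp4 H_nongen_type1_1 homeomorphic_space
           prod_topology (top_of_set dd) (prod_topology (top_of_set aa)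
             (prod_topology (top_of_set aa) angle_space))) \<and>
         (mod_PSp4 H_nongen_type1_2 homeomorphic_space
           prod_topology (top_of_set aa) (prod_topology (top_of_set dd)
             (prod_topology (top_of_set aa) angle_space))) \<and>
         (mod_PSp4 H_nongen_type1_3 homeomorphic_space
           prod_topology (top_of_set aa) (prod_topology (top_of_set aa)
             (prod_topology (top_of_set dd) angle_space)))"
proof -
  let ?d = "top_of_set dd" and ?a = "top_of_set aa"
  have "prod_topology ?d (prod_topology ?a (prod_topology ?a angle_space)) homeomorphic_space
      top_of_set params"
    unfolding params_def prod_topology_subtopology_eu[symmetric]
    by (intro homeomorphic_space_prod_topology dd_homeomorphic aa_homeomorphic
        angle_space_homeomorphic)
  then have hom: "mod_PSp4 (nongeneric_hexagons j) homeomorphic_space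
      prod_topology ?d (prod_topology ?a (prod_topology ?a angle_space))" for j
    using nongeneric_hexagons_homeomorphic_params homeomorphic_space_sym homeomorphic_space_trans
    by blast
  \<comment> \<open>The three orbit spaces share their parameters; only the position of the diagonal
    factor, which records the non-generic quadruple, varies.\<close>
  have swap1: "prod_topology ?d (prod_topology ?a X) homeomorphic_space
      prod_topology ?a (prod_topology ?d X)" for X :: "'x topology"
    by (rule prod_topology_swap_left)
  have swap2: "prod_topology ?a (prod_topology ?d (prod_topology ?a angle_space)) homeomorphic_space
      prod_topology ?a (prod_topology ?a (prod_topology ?d angle_space))"
    by (intro homeomorphic_space_prod_topology homeomorphic_space_refl prod_topology_swap_left)
  have hom2: "mod_PSp4 (nongeneric_hexagons j) homeomorphic_space
      prod_topology ?a (prod_topology ?d (prod_topology ?a angle_space))" for j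
    using homeomorphic_space_trans[OF hom swap1] .
  show ?thesis
    using hom[of 1] hom2[of 2] homeomorphic_space_trans[OF hom2 swap2, of 3]
    by (simp add: nongeneric_hexagons_def)
qed

end
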